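(* Let $s\ge1$ and $n,m\in\mathbb{N}=\{1,2,\ldots\}$. Regard $$K_n(z,w)=2^{-n}\sum_{j=0}^{\lfloor n/2\rfloor}\frac{1}{j!\,(s\kappa_0+s\kappa_1+1)_{n-j}}(z\overline zw\overline w)^jP_{n-2j}(z,w)$$ as a rational function of $(\kappa_0,\kappa_1)$ with coefficients in $\mathbb{Q}[z,\overline z,w,\overline w]$. Then $K_n(z,w)$ has a removable singularity at $\kappa_0+\kappa_1=-m$; that is, when $K_n(z,w)$ is expressed as a quotient of polynomials in $\kappa_0,\kappa_1$ in lowest terms, the denominator is not divisible by $\kappa_0+\kappa_1+m$.
   Context: Notation: $(x)_n=x(x+1)\cdots(x+n-1)$, $(x)_0=1$. $z,\overline z,w,\overline w$ are treated as independent variables; $f(z)$ abbreviates $f(z,\overline z)$; $f(z^k)$ means $f(z^k,\overline z^k)$ and $f(\overline z^k)$ means $f(\overline z^k,z^k)$; similarly for $w$. Polynomials $f_n^0,f_n^1,f_n$: let $P_n^{(\alpha,\beta)}(x)=\frac1{n!}\sum_{l=0}^n\frac{(-n)_l(n+\alpha+\beta+1)_l(\alpha+1+l)_{n-l}}{l!}\left(\frac{1-x}{2}\right)^l$ be the Jacobi polynomials, $P_{-1}^{(\alpha,\beta)}=0$, and put $x=\frac{z^2+\overline z^2}{2z\overline z}$. For $n\ge0$, $$f_{2n}^0=(z\overline z)^nP_n^{(\kappa_0-\frac12,\kappa_1-\frac12)}(x),\qquad f_{2n}^1=\tfrac14(z^2-\overline z^2)(z\overline z)^{n-1}P_{n-1}^{(\kappa_0+\frac12,\kappa_1+\frac12)}(x),$$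 $$f_{2n+1}^0=\left(n+\kappa_0+\tfrac12\right)\tfrac{z+\overline z}{2}(z\overline z)^nP_n^{(\kappa_0-\frac12,\kappa_1+\frac12)}(x),\qquad f_{2n+1}^1=\left(n+\kappa_1+\tfrac12\right)\tfrac{z-\overline z}{2}(z\overline z)^nP_n^{(\kappa_0+\frac12,\kappa_1-\frac12)}(x),$$ and $f_n=f_n^0+f_n^1$. Structural constants (rational functions of $\kappa_0,\kappa_1$): for $n\ge1$, $$\lambda_{2n}^0=\frac{n!\,(\kappa_0+\kappa_1+1)_{n-1}(\kappa_0+\kappa_1+2n)}{(\kappa_0+\frac12)_n(\kappa_1+\frac12)_n},\qquad \lambda_{2n}^1=\frac{(n-1)!\,(\kappa_0+\kappa_1+1)_n(\kappa_0+\kappa_1+2n)}{(\kappa_0+\frac12)_n(\kappa_1+\frac12)_n};$$ for $n\ge0$, $$\lambda_{2n+1}^0=\frac{n!\,(\kappa_0+\kappa_1+1)_n(\kappa_0+\kappa_1+2n+1)}{(n+\kappa_0+\frac12)(\kappa_0+\frac12)_{n+1}(\kappa_1+\frac12)_{n+1}},\qquad \lambda_{2n+1}^1=\frac{n!\,(\kappa_0+\kappa_1+1)_n(\kappa_0+\kappa_1+2n+1)}{(n+\kappa_1+\frac12)(\kappa_0+\frac12)_{n+1}(\kappa_1+\frac12)_{n+1}},$$ $$\lambda_{2n}=\frac{n!\,(\kappa_0+\kappa_1+1)_n}{(\kappa_0+\frac12)_n(\kappa_1+\frac12)_n},\qquad \lambda_{2n+1}=\frac{n!\,(\kappa_0+\kappa_1+1)_n}{(\kappa_0+\frac12)_{n+1}(\kappa_1+\frac12)_{n+1}}.$$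 The components $P_N(z,w)$ of the Poisson kernel: $P_0=1$; for $k\ge1$, $$P_{sk}(z,w)=\lambda_k^0f_k^0(z^s)f_k^0(w^s)+\lambda_k^1f_k^1(z^s)f_k^1(\overline w^s);$$ for $k\ge0$ and $1\le t<s$, $$P_{sk+t}(z,w)=\lambda_k\left(z^t\overline w^tf_k(z^s)f_k(\overline w^s)+\overline z^tw^tf_k(\overline z^s)f_k(w^s)\right).$$ *)

theory Defs
  imports "HOL-Computational_Algebra.Computational_Algebra" "HOL-Computational_Algebra.Field_as_Ring"
begin

instance fract :: ("{idom, ring_char_0}") field_char_0
proof
  have "Fract (of_nat m) 1 = Fract (of_nat n) (1 :: 'a) \<Longrightarrow> m = n" for m n
    by (simp add: eq_fract)
  then show "inj (of_nat :: nat \<Rightarrow> 'a fract)"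
    by (simp add: inj_def of_nat_fract)
qed

(* All functions are given by their closed formulas over a field, for nonzero z, zb; they are
   used below only at (powers of) indeterminates.  The letters zb, wb stand for the conjugate
   variables, which are independent of z, w.  So f(z^k) is f at (z^k, zb^k), and f evaluated at
   the k-th power of the conjugate of z is f at (zb^k, z^k). *)

definition jacobi_P :: "nat \<Rightarrow> 'a::field_char_0 \<Rightarrow> 'a \<Rightarrow> 'a \<Rightarrow> 'a" where
  "jacobi_P n \<alpha> \<beta> x =
     1 / fact n * (\<Sum>l=0..n. pochhammer (- of_nat n) l * pochhammer (of_nat n + \<alpha> + \<beta> + 1) l
        * pochhammer (\<alpha> + 1 + of_nat l) (n - l) / fact l * ((1 - x) / 2) ^ l)"

definition jacobi_arg :: "'a::field_char_0 \<Rightarrow> 'a \<Rightarrow> 'a" where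
  "jacobi_arg z zb = (z\<^sup>2 + zb\<^sup>2) / (2 * z * zb)"

definition f0 :: "'a::field_char_0 \<Rightarrow> 'a \<Rightarrow> nat \<Rightarrow> 'a \<Rightarrow> 'a \<Rightarrow> 'a" where
  "f0 \<kappa>0 \<kappa>1 N z zb = (let n = N div 2; x = jacobi_arg z zb in
     if even N then (z * zb) ^ n * jacobi_P n (\<kappa>0 - 1/2) (\<kappa>1 - 1/2) x
     else (of_nat n + \<kappa>0 + 1/2) * ((z + zb) / 2) * (z * zb) ^ n
            * jacobi_P n (\<kappa>0 - 1/2) (\<kappa>1 + 1/2) x)"

(* The value 0 for N = 0 is the convention that the Jacobi polynomial of degree -1 is 0. *)
definition f1 :: "'a::field_char_0 \<Rightarrow> 'a \<Rightarrow> nat \<Rightarrow> 'a \<Rightarrow> 'a \<Rightarrow> 'a" where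
  "f1 \<kappa>0 \<kappa>1 N z zb = (let n = N div 2; x = jacobi_arg z zb in
     if N = 0 then 0
     else if even N then 1/4 * (z\<^sup>2 - zb\<^sup>2) * (z * zb) ^ (n - 1)
            * jacobi_P (n - 1) (\<kappa>0 + 1/2) (\<kappa>1 + 1/2) x
     else (of_nat n + \<kappa>1 + 1/2) * ((z - zb) / 2) * (z * zb) ^ n
            * jacobi_P n (\<kappa>0 + 1/2) (\<kappa>1 - 1/2) x)"

definition f_sum :: "'a::field_char_0 \<Rightarrow> 'a \<Rightarrow> nat \<Rightarrow> 'a \<Rightarrow> 'a \<Rightarrow> 'a" where
  "f_sum \<kappa>0 \<kappa>1 N z zb = f0 \<kappa>0 \<kappa>1 N z zb + f1 \<kappa>0 \<kappa>1 N z zb"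

(* lam0 and lam1 are meaningful for N >= 1 only. *)
definition lam0 :: "'a::field_char_0 \<Rightarrow> 'a \<Rightarrow> nat \<Rightarrow> 'a" where
  "lam0 \<kappa>0 \<kappa>1 N = (let n = N div 2 in
     if even N then
       fact n * pochhammer (\<kappa>0 + \<kappa>1 + 1) (n - 1) * (\<kappa>0 + \<kappa>1 + 2 * of_nat n)
         / (pochhammer (\<kappa>0 + 1/2) n * pochhammer (\<kappa>1 + 1/2) n)
     else
       fact n * pochhammer (\<kappa>0 + \<kappa>1 + 1) n * (\<kappa>0 + \<kappa>1 + 2 * of_nat n + 1)
         / ((of_nat n + \<kappa>0 + 1/2) * pochhammer (\<kappa>0 + 1/2) (n + 1) * pochhammer (\<kappa>1 + 1/2) (n + 1)))"

definition lam1 :: "'a::field_char_0 \<Rightarrow> 'a \<Rightarrow> nat \<Rightarrow> 'a" where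
  "lam1 \<kappa>0 \<kappa>1 N = (let n = N div 2 in
     if even N then
       fact (n - 1) * pochhammer (\<kappa>0 + \<kappa>1 + 1) n * (\<kappa>0 + \<kappa>1 + 2 * of_nat n)
         / (pochhammer (\<kappa>0 + 1/2) n * pochhammer (\<kappa>1 + 1/2) n)
     else
       fact n * pochhammer (\<kappa>0 + \<kappa>1 + 1) n * (\<kappa>0 + \<kappa>1 + 2 * of_nat n + 1)
         / ((of_nat n + \<kappa>1 + 1/2) * pochhammer (\<kappa>0 + 1/2) (n + 1) * pochhammer (\<kappa>1 + 1/2) (n + 1)))"

definition lam :: "'a::field_char_0 \<Rightarrow> 'a \<Rightarrow> nat \<Rightarrow> 'a" where
  "lam \<kappa>0 \<kappa>1 N = (let n = N div 2 in
     if even N then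
       fact n * pochhammer (\<kappa>0 + \<kappa>1 + 1) n
         / (pochhammer (\<kappa>0 + 1/2) n * pochhammer (\<kappa>1 + 1/2) n)
     else
       fact n * pochhammer (\<kappa>0 + \<kappa>1 + 1) n
         / (pochhammer (\<kappa>0 + 1/2) (n + 1) * pochhammer (\<kappa>1 + 1/2) (n + 1)))"

definition poisson_P :: "nat \<Rightarrow> 'a::field_char_0 \<Rightarrow> 'a \<Rightarrow> nat \<Rightarrow> 'a \<Rightarrow> 'a \<Rightarrow> 'a \<Rightarrow> 'a \<Rightarrow> 'a" where
  "poisson_P s \<kappa>0 \<kappa>1 N z zb w wb = (let k = N div s; t = N mod s in
     if N = 0 then 1
     else if t = 0 then
       lam0 \<kappa>0 \<kappa>1 k * f0 \<kappa>0 \<kappa>1 k (z^s) (zb^s) * f0 \<kappa>0 \<kappa>1 k (w^s) (wb^s)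
       + lam1 \<kappa>0 \<kappa>1 k * f1 \<kappa>0 \<kappa>1 k (z^s) (zb^s) * f1 \<kappa>0 \<kappa>1 k (wb^s) (w^s)
     else
       lam \<kappa>0 \<kappa>1 k *
         (z^t * wb^t * f_sum \<kappa>0 \<kappa>1 k (z^s) (zb^s) * f_sum \<kappa>0 \<kappa>1 k (wb^s) (w^s)
          + zb^t * w^t * f_sum \<kappa>0 \<kappa>1 k (zb^s) (z^s) * f_sum \<kappa>0 \<kappa>1 k (w^s) (wb^s)))"

definition kernel_K :: "nat \<Rightarrow> 'a::field_char_0 \<Rightarrow> 'a \<Rightarrow> nat \<Rightarrow> 'a \<Rightarrow> 'a \<Rightarrow> 'a \<Rightarrow> 'a \<Rightarrow> 'a" where
  "kernel_K s \<kappa>0 \<kappa>1 n z zb w wb =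
     1 / 2 ^ n * (\<Sum>j=0..n div 2.
       1 / (fact j * pochhammer (of_nat s * \<kappa>0 + of_nat s * \<kappa>1 + 1) (n - j))
       * (z * zb * w * wb) ^ j * poisson_P s \<kappa>0 \<kappa>1 (n - 2 * j) z zb w wb)"

(* Polynomial rings in several variables are iterated univariate polynomial rings, the innermost
   variable first: Q[z][zb][w][wb], and over it the polynomials in kappa0, kappa1. *)
type_synonym coeff_ring = "rat poly poly poly poly"
type_synonym kappa_poly = "coeff_ring poly poly"

definition Z_var :: coeff_ring where "Z_var = [:[:[:[:0, 1:]:]:]:]"
definition Zb_var :: coeff_ring where "Zb_var = [:[:[:0, 1:]:]:]"
definition W_var :: coeff_ring where "W_var = [:[:0, 1:]:]"
definition Wb_var :: coeff_ring where "Wb_var = [:0, 1:]"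

definition kappa0 :: kappa_poly where "kappa0 = [:[:0, 1:]:]"
definition kappa1 :: kappa_poly where "kappa1 = [:0, 1:]"

definition coeff_embed :: "coeff_ring \<Rightarrow> kappa_poly fract" where
  "coeff_embed c = to_fract [:[:c:]:]"

definition K_rat :: "nat \<Rightarrow> nat \<Rightarrow> kappa_poly fract" where
  "K_rat s n = kernel_K s (to_fract kappa0) (to_fract kappa1) n
     (coeff_embed Z_var) (coeff_embed Zb_var) (coeff_embed W_var) (coeff_embed Wb_var)"

end

theory Submission
  imports Defs
begin

text \<open>
  Write \<open>Q = z zb w wb\<close> and \<open>d = \<kappa>0 + \<kappa>1 + m\<close>. The factor
  \<open>1 / (s \<kappa>0 + s \<kappa>1 + 1)\<^sub>n\<^sub>-\<^sub>j\<close> has a simple pole along \<open>d = 0\<close> exactly when \<open>j \<le> M := n - s m\<close>,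
  and its residue is proportional to \<open>1 / (M - j)!\<close>. On \<open>d = 0\<close> the Poisson components satisfy
  \<open>P\<^sub>N = 0\<close> for \<open>N > 2 s m\<close> and \<open>Q\<^sup>i P\<^sub>N = - Q\<^sup>i\<^sup>' P\<^sub>N\<^sub>'\<close> whenever \<open>N + N' = 2 s m\<close> and
  \<open>N + 2 i = N' + 2 i'\<close>. Hence the summands of the residue at \<open>j\<close> and \<open>M - j\<close> cancel.

  The antisymmetry of \<open>P\<^sub>N\<close> holds because the Jacobi polynomials are Gauss series with parameters
  \<open>-p\<close> and \<open>-q\<close>, where \<open>p + q\<close> is \<open>m\<close> or \<open>m - 1\<close> on \<open>d = 0\<close>, so that exchanging \<open>p\<close> and \<open>q\<close>
  changes only the normalising constants. When \<open>s\<close> does not divide \<open>N\<close>, an even and an odd index are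
  paired, and two contiguous relations turn \<open>f\<^sub>2\<^sub>q\<^sub>+\<^sub>1(z)\<close> into a multiple of \<open>f\<^sub>2\<^sub>p(zb) / z\<close>.
\<close>

section \<open>Truncated Gauss series\<close>

text \<open>The truncation at \<open>L\<close> is immaterial once \<open>a\<close> or \<open>b\<close> is a nonpositive integer \<open>\<ge> -L\<close>; a common
  bound makes the symmetry in \<open>a\<close> and \<open>b\<close> a literal identity.\<close>

definition hyp :: "nat \<Rightarrow> 'a::field_char_0 \<Rightarrow> 'a \<Rightarrow> 'a \<Rightarrow> 'a \<Rightarrow> 'a" where
  "hyp L a b c u = (\<Sum>l\<le>L. pochhammer a l * pochhammer b l / (pochhammer c l * fact l) * u ^ l)"

lemma hyp_commute: "hyp L a b c u = hyp L b a c u"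
  by (simp add: hyp_def mult.commute)

lemma pochhammer_nonzero:
  fixes c :: "'a::field_char_0"
  assumes "c \<notin> \<int>"
  shows "pochhammer c l \<noteq> 0"
  using assms by (auto simp: pochhammer_eq_0_iff)

lemma not_Ints_add_nonzero:
  fixes c :: "'a::field_char_0"
  assumes "c \<notin> \<int>"
  shows "c + of_int i \<noteq> 0"
proof
  assume "c + of_int i = 0"
  then have "c = of_int (- i)" by (simp add: add_eq_0_iff2)
  then show False using assms Ints_of_int by metis
qed

lemma pochhammer_shift:
  "a * pochhammer (a + 1) l = pochhammer a l * (a + of_nat l)" for a :: "'a::comm_ring_1"
  using pochhammer_rec[of a l] pochhammer_Suc[of a l] by simp

text \<open>The factor \<open>pochhammer (c + of_nat l) (n - l)\<close> is the quotient of
  \<open>pochhammer c n\<close> by \<open>pochhammer c l\<close>, and the terms with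
  \<open>l > n\<close> vanish together with \<open>pochhammer (- of_nat n) l\<close>.\<close>

lemma jacobi_P_hyp:
  fixes \<alpha> :: "'a::field_char_0"
  assumes c: "\<alpha> + 1 = c" "c \<notin> \<int>" and b: "b = of_nat n + \<alpha> + \<beta> + 1" and L: "n \<le> L"
  shows "jacobi_P n \<alpha> \<beta> x
           = pochhammer c n / fact n * hyp L (- of_nat n) b c ((1 - x) / 2)"
proof -
  let ?t = "\<lambda>l. pochhammer (- of_nat n) l * pochhammer b l / (pochhammer c l * fact l) * ((1 - x) / 2) ^ l"
  have "hyp L (- of_nat n) b c ((1 - x) / 2) = (\<Sum>l=0..n. ?t l)"
    unfolding hyp_def
    using L by (intro sum.mono_neutral_right) (auto simp: pochhammer_of_nat_eq_0_iff)
  moreover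
  have "pochhammer (- of_nat n) l * pochhammer b l
        * pochhammer (c + of_nat l) (n - l) / fact l * ((1 - x) / 2) ^ l = pochhammer c n * ?t l"
    if "l \<in> {0..n}" for l
    using that pochhammer_nonzero[OF c(2), of l] pochhammer_product[of l n c]
    by (simp add: field_simps)
  then have "(\<Sum>l=0..n. pochhammer (- of_nat n) l * pochhammer b l
        * pochhammer (c + of_nat l) (n - l) / fact l * ((1 - x) / 2) ^ l) = pochhammer c n * (\<Sum>l=0..n. ?t l)"
    unfolding sum_distrib_left by (rule sum.cong[OF refl])
  ultimately show ?thesis
    unfolding jacobi_P_def c(1) b[symmetric] by simp
qed

text \<open>Compared coefficientwise over the common lower parameter \<open>c + 1\<close>, the
  relation reduces to \<open>(c + l) - (c - a) = a + l\<close>. It therefore survives truncation at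
  any \<open>L\<close>.\<close>

lemma hyp_contiguous_upper_lower:
  fixes c :: "'a::field_char_0"
  assumes "c \<notin> \<int>"
  shows "hyp L a b c u - (c - a) / c * hyp L a b (c + 1) u = a / c * hyp L (a + 1) b (c + 1) u"
proof -
  have nz: "c \<noteq> 0" "pochhammer c l \<noteq> 0" "c + of_nat l \<noteq> 0" "pochhammer (c + 1) l \<noteq> 0" for l
    using assms not_Ints_add_nonzero[of c "int l"] not_Ints_add_nonzero[of c 0]
    by (auto intro!: pochhammer_nonzero)
  have c1: "pochhammer (c + 1) l = pochhammer c l * (c + of_nat l) / c" for l
    using pochhammer_shift[of c l] nz(1) by (simp add: nonzero_eq_divide_eq mult.commute)
  have "pochhammer a l * pochhammer b l / (pochhammer c l * fact l) * u ^ l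
      - (c - a) / c * (pochhammer a l * pochhammer b l / (pochhammer (c + 1) l * fact l) * u ^ l)
      = a / c * (pochhammer (a + 1) l * pochhammer b l / (pochhammer (c + 1) l * fact l) * u ^ l)" for l
  proof -
    have *: "a / c * (pochhammer (a + 1) l * pochhammer b l / (pochhammer (c + 1) l * fact l) * u ^ l)
       = (a * pochhammer (a + 1) l) / c * pochhammer b l / (pochhammer (c + 1) l * fact l) * u ^ l"
      by simp
    show ?thesis
      unfolding * unfolding pochhammer_shift c1
      using nz(1) nz(2,3)[of l] by (simp add: divide_simps) (simp add: algebra_simps)
  qed
  then show ?thesis
    unfolding hyp_def sum_distrib_left sum_subtractf[symmetric] by simp
qed

text \<open>Multiplication by \<open>u\<close> shifts coefficients by one, so the left side could
  have a term of degree \<open>L + 1\<close>, beyond the truncation; \<open>aL\<close> makes its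
  coefficient vanish.\<close>

lemma hyp_contiguous_argument:
  fixes c :: "'a::field_char_0"
  assumes c: "c \<notin> \<int>" and aL: "pochhammer a L = 0"
  shows "(1 - u) * hyp L a b c u + u * (c - a) / c * hyp L a b (c + 1) u = hyp L a (b - 1) c u"
proof -
  have nz: "c \<noteq> 0" "pochhammer c l \<noteq> 0" "c + of_nat l \<noteq> 0" for l
    using c not_Ints_add_nonzero[of c "int l"] not_Ints_add_nonzero[of c 0]
    by (auto intro!: pochhammer_nonzero)
  have c1: "pochhammer (c + 1) l = pochhammer c l * (c + of_nat l) / c" for l
    using pochhammer_shift[of c l] nz(1) by (simp add: nonzero_eq_divide_eq mult.commute)
  define h where "h l = pochhammer a l * pochhammer b l / (pochhammer c l * fact l)" for l
  \<comment> \<open>The coefficient of \<open>u ^ l\<close> in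
    \<open>hyp L a b c u - (c - a) / c * hyp L a b (c + 1) u\<close>, which is the part of the left
    side multiplied by \<open>- u\<close>.\<close>
  define g where "g l = h l * (1 - (c - a) / (c + of_nat l))" for l
  have g: "h (Suc l) - g l
      = pochhammer a (Suc l) * pochhammer (b - 1) (Suc l) / (pochhammer c (Suc l) * fact (Suc l))" for l
  proof -
    have "pochhammer (b - 1) (Suc l) = (b - 1) * pochhammer b l"
      using pochhammer_rec[of "b - 1" l] by simp
    then show ?thesis
      unfolding g_def h_def pochhammer_Suc[of a] pochhammer_Suc[of b] pochhammer_Suc[of c] fact_Suc
      using nz(2,3)[of l] of_nat_neq_0[of l, where 'a='a]
      by (simp add: divide_simps del: of_nat_Suc) (simp add: algebra_simps)
  qed
  have "hyp L a b c u - (c - a) / c * hyp L a b (c + 1) u = (\<Sum>l\<le>L. g l * u ^ l)"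
    unfolding hyp_def g_def h_def c1 sum_distrib_left sum_subtractf[symmetric]
    using nz by (intro sum.cong) (simp_all add: divide_simps, simp add: algebra_simps)
  also have "\<dots> = (\<Sum>l<L. g l * u ^ l)"
    using aL by (simp add: lessThan_Suc_atMost[symmetric] g_def h_def)
  finally have *: "hyp L a b c u - (c - a) / c * hyp L a b (c + 1) u = (\<Sum>l<L. g l * u ^ l)" .
  have h: "hyp L a b c u = (\<Sum>l\<le>L. h l * u ^ l)"
    unfolding hyp_def h_def ..
  have "(1 - u) * hyp L a b c u + u * (c - a) / c * hyp L a b (c + 1) u
      = hyp L a b c u - u * (hyp L a b c u - (c - a) / c * hyp L a b (c + 1) u)"
    by (simp add: ring_distribs)
  also have "\<dots> = (\<Sum>l\<le>L. h l * u ^ l) - u * (\<Sum>l<L. g l * u ^ l)"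
    by (subst *) (simp only: h)
  also have "\<dots>
      = h 0 + (\<Sum>l<L. (h (Suc l) - g l) * u ^ Suc l)"
    by (simp add: sum.atMost_shift sum_distrib_left sum_subtractf algebra_simps)
  also have "\<dots> = hyp L a (b - 1) c u"
    unfolding g unfolding hyp_def h_def by (simp add: sum.atMost_shift)
  finally show ?thesis .
qed

section \<open>Pochhammer symbols at negative integers and under reflection\<close>

lemma pochhammer_minus_of_nat:
  assumes "p + q = m"
  shows "pochhammer (- of_nat m :: 'a::field_char_0) p = (-1) ^ p * fact m / fact q"
proof -
  have "pochhammer (- of_nat m :: 'a) p = (-1) ^ p * pochhammer (of_nat m - of_nat p + 1) p"
    by (rule pochhammer_minus)
  also have "of_nat m - of_nat p + 1 = (1 + of_nat q :: 'a)"
    using assms by auto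
  also have "fact q * pochhammer (1 + of_nat q :: 'a) p = fact m"
    using pochhammer_product'[of "1::'a" q p] assms by (simp add: pochhammer_fact add.commute)
  then have "pochhammer (1 + of_nat q :: 'a) p = fact m / fact q"
    by (simp add: field_simps)
  finally show ?thesis by simp
qed

text \<open>On the line, \<open>k1 + 1/2\<close> equals \<open>1 - of_nat m - c\<close>, so this
  expresses the denominators coming from \<open>k1\<close> through Pochhammer symbols of
  \<open>c\<close>.\<close>

lemma pochhammer_reflect:
  fixes c :: "'a::field_char_0"
  assumes "p + q = m" and c: "c \<notin> \<int>"
  shows "pochhammer (1 - of_nat m - c) p = (-1) ^ p * pochhammer c m / pochhammer c q"
proof -
  have "pochhammer (1 - of_nat m - c) p = pochhammer (- (c + of_nat m - 1)) p"
    by (simp add: algebra_simps)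
  also have "\<dots> = (-1) ^ p * pochhammer (c + of_nat m - 1 - of_nat p + 1) p"
    by (rule pochhammer_minus)
  also have "c + of_nat m - 1 - of_nat p + 1 = c + of_nat q"
    using assms by auto
  also have "pochhammer (c + of_nat q) p = pochhammer c m / pochhammer c q"
    using pochhammer_product'[of c q p] assms pochhammer_nonzero[OF c, of q]
    by (simp add: add.commute)
  finally show ?thesis by simp
qed

section \<open>The argument of the Gauss series\<close>

definition half_arg :: "'a::field_char_0 \<Rightarrow> 'a \<Rightarrow> 'a" where
  "half_arg z zb = (1 - jacobi_arg z zb) / 2"

lemma half_arg_commute: "half_arg z zb = half_arg zb z"
  by (simp add: half_arg_def jacobi_arg_def ac_simps)

lemma half_arg_eq:
  assumes "z \<noteq> 0" "zb \<noteq> 0"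
  shows "half_arg z zb = - ((z - zb) / 2)\<^sup>2 / (z * zb)"
  using assms by (simp add: half_arg_def jacobi_arg_def field_simps power2_eq_square)

lemma one_minus_half_arg:
  assumes "z \<noteq> 0" "zb \<noteq> 0"
  shows "1 - half_arg z zb = ((z + zb) / 2)\<^sup>2 / (z * zb)"
  using assms by (simp add: half_arg_def jacobi_arg_def field_simps power2_eq_square)

lemma hyp_0: "hyp L 0 b c u = 1"
  unfolding hyp_def by (subst sum.atMost_shift) (simp add: pochhammer_rec del: sum.lessThan_Suc)

text \<open>The common last step of the antisymmetry proofs: once two components agree up to a power
  of \<open>Q\<close> and an exchange of \<open>x\<close> and \<open>y\<close>, only the exponents
  remain to be compared.\<close>

lemma power_mult_antisymmetric:
  assumes "j + a = j' + (b :: nat)"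
    and "P = (x - y) * e * Q ^ a * (X :: 'a::comm_ring_1)" and "P' = (y - x) * e * Q ^ b * X"
  shows "Q ^ j * P + Q ^ j' * P' = 0"
proof -
  have "Q ^ j * P = (x - y) * e * X * Q ^ (j + a)" and "Q ^ j' * P' = (y - x) * e * X * Q ^ (j' + b)"
    using assms(2,3) by (simp_all add: power_add)
  then show ?thesis using assms(1) by (simp add: left_diff_distrib)
qed

section \<open>The Poisson components on \<open>\<kappa>0 + \<kappa>1 = - m\<close>\<close>

context
  fixes c k0 k1 :: "'a::field_char_0" and m :: nat
  assumes c: "c \<notin> \<int>" and m: "m \<ge> 1"
    and k0: "k0 + 1/2 = c" and k1: "k1 + 1/2 = 1 - of_nat m - c"
begin

section \<open>The polynomials as Gauss series on the line, with \<open>c = k0 + 1/2\<close> as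
  parameter\<close>

lemma k_sum: "k0 + k1 = - of_nat m"
proof -
  have "k0 + k1 = (k0 + 1/2) + (k1 + 1/2) - 1" by simp
  also have "\<dots> = - of_nat m" unfolding k0 k1 by simp
  finally show ?thesis .
qed

lemma k1_eq: "k1 = - of_nat m - k0"
  using k_sum by (simp add: algebra_simps add_eq_0_iff2)

lemma c_nonzero: "c \<noteq> 0" "c + of_nat i \<noteq> 0" "pochhammer c i \<noteq> 0"
  using c not_Ints_add_nonzero[OF c, of "int i"] pochhammer_nonzero[OF c] by auto

lemma c1_not_Ints: "c + 1 \<notin> \<int>"
  using c by (metis Ints_1 Ints_diff add_diff_cancel_right')

lemma pochhammer_c1: "pochhammer (c + 1) p = pochhammer c (Suc p) / c"
  using pochhammer_rec[of c p] c_nonzero by (simp add: field_simps)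

text \<open>The second upper parameter of the Gauss series is
  \<open>p + k0 + k1 = p - m = - q\<close>, which is where the complementary degree \<open>q\<close>
  enters.\<close>

lemma f0_even:
  assumes "p + q = m"
  shows "f0 k0 k1 (2 * p) z zb
    = pochhammer c p / fact p * (z * zb) ^ p * hyp m (- of_nat p) (- of_nat q) c (half_arg z zb)"
proof -
  have "jacobi_P p (k0 - 1/2) (k1 - 1/2) (jacobi_arg z zb)
     = pochhammer c p / fact p * hyp m (- of_nat p) (- of_nat q) c (half_arg z zb)"
    unfolding half_arg_def using assms by (intro jacobi_P_hyp c) (auto simp: k1_eq simp flip: k0)
  then show ?thesis by (simp add: f0_def)
qed

text \<open>Written with the same normalising constant as \<open>f0_even\<close>. The remaining
  factor \<open>of_nat p\<close> vanishes at \<open>p = 0\<close>, in agreement with the convention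
  for degree -1.\<close>

lemma f1_even:
  assumes "p + q = m" and nz: "z \<noteq> 0" "zb \<noteq> 0"
  shows "f1 k0 k1 (2 * p) z zb
    = pochhammer c p / fact p * (z * zb) ^ p
      * (of_nat p / c * ((z\<^sup>2 - zb\<^sup>2) / (4 * (z * zb)))
         * hyp m (1 - of_nat p) (1 - of_nat q) (c + 1) (half_arg z zb))"
proof (cases p)
  case 0
  then show ?thesis by (simp add: f1_def)
next
  case (Suc r)
  have "jacobi_P r (k0 + 1/2) (k1 + 1/2) (jacobi_arg z zb)
     = pochhammer (c + 1) r / fact r
        * hyp m (- of_nat r) (1 - of_nat q) (c + 1) (half_arg z zb)"
    unfolding half_arg_def using assms Suc c1_not_Ints by (intro jacobi_P_hyp) (auto simp: k1_eq simp flip: k0)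
  then have J: "jacobi_P r (k0 + 1/2) (k1 + 1/2) (jacobi_arg z zb)
     = pochhammer (c + 1) r / fact r
        * hyp m (1 - of_nat p) (1 - of_nat q) (c + 1) (half_arg z zb)"
    by (simp add: Suc)
  have "f1 k0 k1 (2 * p) z zb = 1/4 * (z\<^sup>2 - zb\<^sup>2) * (z * zb) ^ r
         * (pochhammer (c + 1) r / fact r
        * hyp m (1 - of_nat p) (1 - of_nat q) (c + 1) (half_arg z zb))"
    unfolding J[symmetric] by (simp add: f1_def Suc)
  also have "pochhammer (c + 1) r / fact r = of_nat p / c * (pochhammer c p / fact p)"
    unfolding pochhammer_c1 using c_nonzero of_nat_neq_0[of r, where 'a='a]
    by (simp add: Suc field_simps del: of_nat_Suc)
  also have "(z * zb) ^ r = (z * zb) ^ p / (z * zb)"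
    using nz by (simp add: Suc)
  finally show ?thesis by (simp add: ac_simps)
qed

lemma f0_odd:
  assumes "p + q + 1 = m"
  shows "f0 k0 k1 (2 * p + 1) z zb
    = pochhammer c (p + 1) / fact p * (z * zb) ^ p
      * ((z + zb) / 2 * hyp m (- of_nat p) (- of_nat q) c (half_arg z zb))"
proof -
  have "jacobi_P p (k0 - 1/2) (k1 + 1/2) (jacobi_arg z zb)
     = pochhammer c p / fact p * hyp m (- of_nat p) (- of_nat q) c (half_arg z zb)"
    unfolding half_arg_def using assms by (intro jacobi_P_hyp c) (auto simp: k1_eq simp flip: k0)
  then show ?thesis
    by (simp add: f0_def pochhammer_Suc flip: k0)
qed

text \<open>The sign comes from the prefactor:
  \<open>p + k1 + 1/2 = p + 1 - m - c = - (c + q)\<close>.\<close>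

lemma f1_odd:
  assumes "p + q + 1 = m"
  shows "f1 k0 k1 (2 * p + 1) z zb
    = - (pochhammer c (p + 1) / fact p * (z * zb) ^ p
      * ((z - zb) / 2 * ((c + of_nat q) / c)
         * hyp m (- of_nat p) (- of_nat q) (c + 1) (half_arg z zb)))"
proof -
  have J: "jacobi_P p (k0 + 1/2) (k1 - 1/2) (jacobi_arg z zb)
     = pochhammer (c + 1) p / fact p * hyp m (- of_nat p) (- of_nat q) (c + 1) (half_arg z zb)"
    unfolding half_arg_def using assms c1_not_Ints by (intro jacobi_P_hyp) (auto simp: k1_eq simp flip: k0)
  have *: "of_nat p + k1 + 1/2 = - (c + of_nat q)"
    using assms unfolding add.assoc k1 by auto
  have "f1 k0 k1 (2 * p + 1) z zb
    = (of_nat p + k1 + 1/2) * ((z - zb) / 2) * (z * zb) ^ p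
            * jacobi_P p (k0 + 1/2) (k1 - 1/2) (jacobi_arg z zb)"
    by (simp add: f1_def)
  then show ?thesis
    unfolding J pochhammer_c1 * by (simp add: ac_simps del: minus_add_distrib)
qed

section \<open>Structure constants on the line\<close>

definition E_const :: "nat \<Rightarrow> nat \<Rightarrow> 'a" where
  "E_const p q = fact (m - 1) / (fact p * fact q) * (pochhammer c p * pochhammer c q / pochhammer c m)"

lemma E_const_commute: "E_const p q = E_const q p"
  by (simp add: E_const_def ac_simps)

text \<open>The constant shared by the index \<open>2 * p\<close> and its partner
  \<open>2 * q + 1\<close>. It is not symmetric in \<open>p\<close> and \<open>q\<close>; the
  antisymmetry in this case is the opposite sign in \<open>lam_even\<close> and
  \<open>lam_odd\<close>.\<close>

definition G_const :: "nat \<Rightarrow> nat \<Rightarrow> 'a" where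
  "G_const p q = fact (m - 1) / (fact p * fact q) * (pochhammer c p * pochhammer c (q + 1) / pochhammer c m)"

lemma pochhammer_k_sum:
  assumes "p + q + 1 = m"
  shows "pochhammer (k0 + k1 + 1) p = (-1) ^ p * fact (m - 1) / fact q"
proof -
  have "k0 + k1 + 1 = - of_nat (m - 1)" using m by (simp add: k_sum of_nat_diff)
  then show ?thesis using pochhammer_minus_of_nat[of p q "m - 1", where 'a='a] assms by simp
qed

lemma pochhammer_k1:
  assumes "p + q = m"
  shows "pochhammer (k1 + 1/2) p = (-1) ^ p * pochhammer c m / pochhammer c q"
proof -
  show ?thesis unfolding k1 using pochhammer_reflect[OF assms c] .
qed

lemma lam_even:
  assumes "p + q + 1 = m"
  shows "lam k0 k1 (2 * p) * (pochhammer c p / fact p)\<^sup>2 = G_const p q"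
proof -
  have "lam k0 k1 (2 * p) = fact p * pochhammer (k0 + k1 + 1) p
         / (pochhammer (k0 + 1/2) p * pochhammer (k1 + 1/2) p)"
    by (simp add: lam_def)
  also have "\<dots> = fact p * ((-1) ^ p * fact (m - 1) / fact q)
         / (pochhammer c p * ((-1) ^ p * pochhammer c m / pochhammer c (q + 1)))"
    using assms pochhammer_k1[of p "q + 1"] by (simp add: pochhammer_k_sum[OF assms] k0)
  finally have L: "lam k0 k1 (2 * p) = \<dots>" .
  show ?thesis
    unfolding L
    using c_nonzero(3)[of p] c_nonzero(3)[of m] c_nonzero(3)[of "q + 1"]
    by (simp add: G_const_def field_simps power2_eq_square)
qed

text \<open>Here the reflected symbol has length \<open>q + 1\<close> while the symbol of
  \<open>k0 + k1 + 1\<close> has length \<open>q\<close>, so one sign is left over; in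
  \<open>lam_even\<close> the two lengths agree.\<close>

lemma lam_odd:
  assumes "p + q + 1 = m"
  shows "lam k0 k1 (2 * q + 1) * (pochhammer c (q + 1) / fact q)\<^sup>2 = - G_const p q"
proof -
  have "lam k0 k1 (2 * q + 1) = fact q * pochhammer (k0 + k1 + 1) q
         / (pochhammer (k0 + 1/2) (q + 1) * pochhammer (k1 + 1/2) (q + 1))"
    by (simp add: lam_def)
  also have "\<dots> = fact q * ((-1) ^ q * fact (m - 1) / fact p)
         / (pochhammer c (q + 1) * ((-1) ^ (q + 1) * pochhammer c m / pochhammer c p))"
    using assms pochhammer_k1[of "q + 1" p] pochhammer_k_sum[of q p] by (simp add: k0)
  finally have L: "lam k0 k1 (2 * q + 1) = \<dots>" .
  show ?thesis
    unfolding L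
    using c_nonzero(3)[of p] c_nonzero(3)[of m] c_nonzero(3)[of "q + 1"]
    by (simp add: G_const_def field_simps power2_eq_square del: pochhammer_Suc)
qed

text \<open>The factor \<open>k0 + k1 + 2 * of_nat p\<close> becomes \<open>p - q\<close>, and the
  Pochhammer lengths \<open>p - 1\<close> and \<open>p\<close> leave one sign. Since
  \<open>E_const\<close> is symmetric, all antisymmetry sits in \<open>q - p\<close>.\<close>

lemma lam0_even:
  assumes "p + q = m" "p \<ge> 1"
  shows "lam0 k0 k1 (2 * p) * (pochhammer c p / fact p)\<^sup>2 = (of_nat q - of_nat p) * E_const p q"
proof -
  obtain r where r: "p = Suc r" using assms by (cases p) auto
  have *: "k0 + k1 + 2 * of_nat p = of_nat p - of_nat q"
    using assms unfolding k_sum by auto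
  have "lam0 k0 k1 (2 * p) = fact p * pochhammer (k0 + k1 + 1) r * (k0 + k1 + 2 * of_nat p)
         / (pochhammer (k0 + 1/2) p * pochhammer (k1 + 1/2) p)"
    by (simp add: lam0_def r)
  also have "\<dots> = fact p * ((-1) ^ r * fact (m - 1) / fact q) * (of_nat p - of_nat q)
         / (pochhammer c p * ((-1) ^ p * pochhammer c m / pochhammer c q))"
    unfolding * pochhammer_k1[OF assms(1)] k0 using assms pochhammer_k_sum[of r q] r by simp
  finally have L: "lam0 k0 k1 (2 * p) = \<dots>" .
  show ?thesis
    unfolding L
    using c_nonzero(3)[of p] c_nonzero(3)[of m] c_nonzero(3)[of q]
    by (simp add: E_const_def r power2_eq_square del: fact_Suc of_nat_Suc)
       (simp add: field_simps del: fact_Suc of_nat_Suc)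
qed

text \<open>The additional \<open>of_nat p\<close> is one of the two supplied by the pair of factors
  \<open>f1\<close>; together with the other one the coefficient \<open>- p * q\<close> is again
  symmetric.\<close>

lemma lam1_even:
  assumes "p + q = m" "p \<ge> 1"
  shows "lam1 k0 k1 (2 * p) * (pochhammer c p / fact p)\<^sup>2 * of_nat p
    = - of_nat q * ((of_nat q - of_nat p) * E_const p q)"
proof -
  obtain r where r: "p = Suc r" using assms by (cases p) auto
  have *: "k0 + k1 + 2 * of_nat p = of_nat p - of_nat q"
    and **: "k0 + k1 + 1 + of_nat r = - of_nat q"
    using assms r unfolding k_sum by auto
  have "lam1 k0 k1 (2 * p) = fact r * pochhammer (k0 + k1 + 1) (Suc r) * (k0 + k1 + 2 * of_nat p)
         / (pochhammer (k0 + 1/2) p * pochhammer (k1 + 1/2) p)"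
    by (simp add: lam1_def r)
  also have "\<dots> = fact r * ((-1) ^ r * fact (m - 1) / fact q * - of_nat q) * (of_nat p - of_nat q)
         / (pochhammer c p * ((-1) ^ p * pochhammer c m / pochhammer c q))"
    unfolding * pochhammer_k1[OF assms(1)] k0 pochhammer_Suc ** using assms pochhammer_k_sum[of r q] r by simp
  finally have L: "lam1 k0 k1 (2 * p) = \<dots>" .
  show ?thesis
    unfolding L
    using c_nonzero(3)[of p] c_nonzero(3)[of m] c_nonzero(3)[of q] of_nat_neq_0[of r, where 'a='a]
    by (simp add: E_const_def r power2_eq_square del: of_nat_Suc)
       (simp add: field_simps del: of_nat_Suc)
qed

lemma lam0_odd:
  assumes "p + q + 1 = m"
  shows "lam0 k0 k1 (2 * p + 1) * (pochhammer c (p + 1) / fact p)\<^sup>2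
    = (of_nat q - of_nat p) * E_const p q"
proof -
  have *: "k0 + k1 + 2 * of_nat p + 1 = of_nat p - of_nat q"
    using assms unfolding k_sum by auto
  have "lam0 k0 k1 (2 * p + 1) = fact p * pochhammer (k0 + k1 + 1) p * (k0 + k1 + 2 * of_nat p + 1)
         / ((of_nat p + (k0 + 1/2)) * pochhammer (k0 + 1/2) (p + 1) * pochhammer (k1 + 1/2) (p + 1))"
    by (simp add: lam0_def add.assoc)
  also have "\<dots> = fact p * ((-1) ^ p * fact (m - 1) / fact q) * (of_nat p - of_nat q)
         / ((of_nat p + c) * pochhammer c (p + 1) * ((-1) ^ (p + 1) * pochhammer c m / pochhammer c q))"
    unfolding * k0 pochhammer_k_sum[OF assms] using assms pochhammer_k1[of "p + 1" q] by simp
  finally have L: "lam0 k0 k1 (2 * p + 1) = \<dots>" .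
  show ?thesis
    unfolding L
    using c_nonzero(3)[of p] c_nonzero(3)[of m] c_nonzero(3)[of q] c_nonzero(2)[of p]
    by (simp add: E_const_def power2_eq_square pochhammer_Suc divide_simps)
       (simp add: algebra_simps)
qed

text \<open>As in the even case, one factor \<open>c + of_nat q\<close> is borrowed from the pair of
  factors \<open>f1\<close>, so that \<open>(c + p) * (c + q)\<close> appears symmetrically.\<close>

lemma lam1_odd:
  assumes "p + q + 1 = m"
  shows "lam1 k0 k1 (2 * p + 1) * (pochhammer c (p + 1) / fact p)\<^sup>2 * (c + of_nat q)
    = - (c + of_nat p) * ((of_nat q - of_nat p) * E_const p q)"
proof -
  have *: "k0 + k1 + 2 * of_nat p + 1 = of_nat p - of_nat q"
    and nz: "- c \<noteq> of_nat q"
    and **: "of_nat p + k1 + 1/2 = - (c + of_nat q)"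
    using assms c_nonzero(2)[of q] unfolding add.assoc[of _ k1] k1 k_sum by (auto simp: minus_equation_iff[of c])
  have "lam1 k0 k1 (2 * p + 1) = fact p * pochhammer (k0 + k1 + 1) p * (k0 + k1 + 2 * of_nat p + 1)
         / ((of_nat p + k1 + 1/2) * pochhammer (k0 + 1/2) (p + 1) * pochhammer (k1 + 1/2) (p + 1))"
    by (simp add: lam1_def)
  also have "\<dots> = fact p * ((-1) ^ p * fact (m - 1) / fact q) * (of_nat p - of_nat q)
         / (- (c + of_nat q) * pochhammer c (p + 1) * ((-1) ^ (p + 1) * pochhammer c m / pochhammer c q))"
    unfolding * ** k0 pochhammer_k_sum[OF assms] using assms pochhammer_k1[of "p + 1" q] by simp
  finally have L: "lam1 k0 k1 (2 * p + 1) = \<dots>" .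
  show ?thesis
    unfolding L
    using nz c_nonzero(3)[of p] c_nonzero(3)[of m] c_nonzero(3)[of q] c_nonzero(2)[of p] c_nonzero(2)[of q]
    by (simp add: E_const_def power2_eq_square pochhammer_Suc divide_simps)
       (simp add: algebra_simps)
qed


text \<open>The polynomials \<open>f\<^sub>2\<^sub>p\<close> and \<open>f\<^sub>2\<^sub>q\<^sub>+\<^sub>1\<close> without the powers of \<open>z zb\<close> and the normalising constants. In
  both, \<open>p\<close> and \<open>q\<close> are the complementary degrees with \<open>p + q + 1 = m\<close>.\<close>

definition even_part :: "nat \<Rightarrow> nat \<Rightarrow> 'a \<Rightarrow> 'a \<Rightarrow> 'a" where
  "even_part p q z zb = hyp m (- of_nat p) (- of_nat q - 1) c (half_arg z zb)
     + of_nat p / c * ((z\<^sup>2 - zb\<^sup>2) / (4 * (z * zb)))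
        * hyp m (1 - of_nat p) (- of_nat q) (c + 1) (half_arg z zb)"

definition odd_part :: "nat \<Rightarrow> nat \<Rightarrow> 'a \<Rightarrow> 'a \<Rightarrow> 'a" where
  "odd_part p q z zb = (z + zb) / 2 * hyp m (- of_nat p) (- of_nat q) c (half_arg z zb)
     - (z - zb) / 2 * ((c + of_nat p) / c) * hyp m (- of_nat p) (- of_nat q) (c + 1) (half_arg z zb)"

lemma f_sum_even:
  assumes "p + q + 1 = m" and nz: "z \<noteq> 0" "zb \<noteq> 0"
  shows "f_sum k0 k1 (2 * p) z zb = pochhammer c p / fact p * (z * zb) ^ p * even_part p q z zb"
proof -
  have pq: "p + (q + 1) = m" using assms by simp
  have "1 - of_nat (q + 1) = (- of_nat q :: 'a)" "- of_nat (q + 1) = (- of_nat q - 1 :: 'a)"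
    by simp_all
  then show ?thesis
    unfolding f_sum_def even_part_def f0_even[OF pq] f1_even[OF pq nz]
    by (simp only: ring_distribs)
qed

lemma f_sum_odd:
  assumes "p + q + 1 = m"
  shows "f_sum k0 k1 (2 * q + 1) z zb
    = pochhammer c (q + 1) / fact q * (z * zb) ^ q * odd_part p q z zb"
proof -
  have qp: "q + p + 1 = m" using assms by simp
  show ?thesis
    unfolding f_sum_def odd_part_def f0_odd[OF qp] f1_odd[OF qp]
      hyp_commute[of m "- of_nat p" "- of_nat q"]
    by (simp add: ring_distribs)
qed

text \<open>With half sum \<open>A\<close> and half difference \<open>B\<close>, the contiguous
  relations express both parts through the same two series \<open>H\<close> and \<open>X\<close>.
  The even part is then a quadratic form that factors as \<open>(A + B) * (A * H - B * X)\<close>,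
  and \<open>A + B = z\<close>.\<close>

lemma odd_part_eq:
  assumes "p + q + 1 = m" and nz: "z \<noteq> 0" "zb \<noteq> 0"
  shows "odd_part p q z zb = zb * even_part p q zb z"
proof -
  define A B where "A = (z + zb) / 2" and "B = (z - zb) / 2"
  have z: "z = A + B" "zb = A - B" by (simp_all add: A_def B_def field_simps)
  define u where "u = half_arg z zb"
  define H X where "H = hyp m (- of_nat p) (- of_nat q) c u"
    and "X = (c + of_nat p) / c * hyp m (- of_nat p) (- of_nat q) (c + 1) u"
  have "pochhammer (- of_nat p :: 'a) m = 0"
    using assms(1) by (simp add: pochhammer_of_nat_eq_0_iff)
  from hyp_contiguous_argument[OF c this, of u "- of_nat q"]
  have 1: "hyp m (- of_nat p) (- of_nat q - 1) c u = (1 - u) * H + u * X"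
    by (simp add: H_def X_def mult.assoc)
  from hyp_contiguous_upper_lower[OF c, of m "- of_nat p" "- of_nat q" u]
  have 2: "of_nat p / c * hyp m (1 - of_nat p) (- of_nat q) (c + 1) u = X - H"
    by (simp add: H_def X_def add.commute) (simp add: algebra_simps)
  have u: "u = - B\<^sup>2 / (z * zb)" "1 - u = A\<^sup>2 / (z * zb)"
    using half_arg_eq[OF nz] one_minus_half_arg[OF nz] by (simp_all add: u_def A_def B_def)
  have 3: "(zb\<^sup>2 - z\<^sup>2) / (4 * (zb * z)) = - (A * B) / (z * zb)"
  proof -
    have "zb\<^sup>2 - z\<^sup>2 = - (4 * (A * B))"
      by (simp add: A_def B_def power2_eq_square field_simps)
    then show ?thesis by simp
  qed
  have "even_part p q zb z = (1 - u) * H + u * X - A * B / (z * zb) * (X - H)"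
    unfolding even_part_def half_arg_commute[of zb z] u_def[symmetric] 1 3 2[symmetric] by (simp add: ac_simps)
  also have "\<dots> = (A\<^sup>2 * H - B\<^sup>2 * X - A * B * (X - H)) / (z * zb)"
    unfolding u(2) unfolding u(1) by (simp add: diff_divide_distrib)
  also have "A\<^sup>2 * H - B\<^sup>2 * X - A * B * (X - H) = z * (A * H - B * X)"
    unfolding z by (simp add: algebra_simps power2_eq_square)
  finally have "zb * even_part p q zb z = A * H - B * X"
    using nz by simp
  then show ?thesis
    by (simp add: odd_part_def A_def B_def H_def X_def u_def)
qed

section \<open>Antisymmetry of the Poisson components\<close>

context
  fixes s :: nat and z zb w wb :: 'a
  assumes s: "s \<ge> 1" and nz: "z \<noteq> 0" "zb \<noteq> 0" "w \<noteq> 0" "wb \<noteq> 0"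
begin

text \<open>The form is chosen so that exchanging \<open>p\<close> and \<open>q\<close> fixes the
  bracket and \<open>E_const\<close>, and changes only the sign of \<open>q - p\<close> and the
  power of \<open>z * zb * w * wb\<close>.\<close>

lemma poisson_even_multiple:
  assumes pq: "p + q = m"
  shows "poisson_P s k0 k1 (s * (2 * p)) z zb w wb
    = (of_nat q - of_nat p) * E_const p q * (z * zb * w * wb) ^ (s * p) *
       (hyp m (- of_nat p) (- of_nat q) c (half_arg (z ^ s) (zb ^ s))
        * hyp m (- of_nat p) (- of_nat q) c (half_arg (w ^ s) (wb ^ s))
      - of_nat p * of_nat q / c\<^sup>2
        * ((((z ^ s)\<^sup>2 - (zb ^ s)\<^sup>2) / (4 * (z ^ s * zb ^ s)))
           * hyp m (1 - of_nat p) (1 - of_nat q) (c + 1) (half_arg (z ^ s) (zb ^ s)))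
        * ((((wb ^ s)\<^sup>2 - (w ^ s)\<^sup>2) / (4 * (wb ^ s * w ^ s)))
           * hyp m (1 - of_nat p) (1 - of_nat q) (c + 1) (half_arg (wb ^ s) (w ^ s))))"
    (is "_ = _ * _ * _ * (?H * ?H' - _ * ?D * ?D')")
proof (cases "p = 0")
  case True
  \<comment> \<open>The component of index 0 is 1 by definition, not through \<open>lam0\<close>, so
    the normalisation of \<open>E_const\<close> has to be checked separately here.\<close>
  have "(fact m :: 'a) = of_nat m * fact (m - 1)"
    using m by (simp add: fact_reduce)
  then have "of_nat m * E_const 0 m = 1"
    using m by (simp add: E_const_def c_nonzero)
  then show ?thesis
    using True pq by (simp add: poisson_P_def hyp_0)
next
  case False
  then have p: "p \<ge> 1" by simp
  have zs: "z ^ s \<noteq> 0" "zb ^ s \<noteq> 0" "w ^ s \<noteq> 0" "wb ^ s \<noteq> 0" using nz by auto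
  define K where "K = pochhammer c p / fact p"
  have "poisson_P s k0 k1 (s * (2 * p)) z zb w wb
    = lam0 k0 k1 (2 * p) * f0 k0 k1 (2 * p) (z^s) (zb^s) * f0 k0 k1 (2 * p) (w^s) (wb^s)
       + lam1 k0 k1 (2 * p) * f1 k0 k1 (2 * p) (z^s) (zb^s) * f1 k0 k1 (2 * p) (wb^s) (w^s)"
    using s p by (simp add: poisson_P_def Let_def)
  also have "\<dots> = lam0 k0 k1 (2 * p) * (K * (z^s * zb^s) ^ p * ?H) * (K * (w^s * wb^s) ^ p * ?H')
    + lam1 k0 k1 (2 * p) * (K * (z^s * zb^s) ^ p * (of_nat p / c * ?D))
         * (K * (wb^s * w^s) ^ p * (of_nat p / c * ?D'))"
    unfolding f0_even[OF pq] f1_even[OF pq zs(1,2)] f1_even[OF pq zs(4,3)] K_def[symmetric]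
    by (simp only: mult.assoc)
  also have "\<dots> = (z * zb * w * wb) ^ (s * p) * ((lam0 k0 k1 (2 * p) * K\<^sup>2) * (?H * ?H')
     + (lam1 k0 k1 (2 * p) * K\<^sup>2 * of_nat p) * (of_nat p / c\<^sup>2) * ?D * ?D')"
    by (simp add: power_mult_distrib power_mult[symmetric] power2_eq_square ring_distribs ac_simps)
  also have "\<dots> = (z * zb * w * wb) ^ (s * p) * (((of_nat q - of_nat p) * E_const p q) * (?H * ?H')
     + (- of_nat q * ((of_nat q - of_nat p) * E_const p q)) * (of_nat p / c\<^sup>2) * ?D * ?D')"
    unfolding K_def lam0_even[OF pq p] lam1_even[OF pq p] ..
  also have "\<dots> = (of_nat q - of_nat p) * E_const p q * (z * zb * w * wb) ^ (s * p) *
      (?H * ?H' - of_nat p * of_nat q / c\<^sup>2 * ?D * ?D')"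
    by (simp add: right_diff_distrib)
  finally show ?thesis .
qed

lemma poisson_odd_multiple:
  assumes pq: "p + q + 1 = m"
  shows "poisson_P s k0 k1 (s * (2 * p + 1)) z zb w wb
    = (of_nat q - of_nat p) * E_const p q * (z * zb * w * wb) ^ (s * p) *
       (((z ^ s + zb ^ s) / 2 * hyp m (- of_nat p) (- of_nat q) c (half_arg (z ^ s) (zb ^ s)))
        * ((w ^ s + wb ^ s) / 2 * hyp m (- of_nat p) (- of_nat q) c (half_arg (w ^ s) (wb ^ s)))
      - (c + of_nat p) * (c + of_nat q) / c\<^sup>2
        * ((z ^ s - zb ^ s) / 2
           * hyp m (- of_nat p) (- of_nat q) (c + 1) (half_arg (z ^ s) (zb ^ s)))
        * ((wb ^ s - w ^ s) / 2
           * hyp m (- of_nat p) (- of_nat q) (c + 1) (half_arg (wb ^ s) (w ^ s))))"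
    (is "_ = _ * _ * _ * (?H * ?H' - _ * ?D * ?D')")
proof -
  define K where "K = pochhammer c (p + 1) / fact p"
  have "poisson_P s k0 k1 (s * (2 * p + 1)) z zb w wb
    = lam0 k0 k1 (2 * p + 1) * f0 k0 k1 (2 * p + 1) (z^s) (zb^s) * f0 k0 k1 (2 * p + 1) (w^s) (wb^s)
       + lam1 k0 k1 (2 * p + 1) * f1 k0 k1 (2 * p + 1) (z^s) (zb^s) * f1 k0 k1 (2 * p + 1) (wb^s) (w^s)"
    unfolding poisson_P_def Let_def using s by (simp del: mult_Suc_right)
  also have "\<dots> = lam0 k0 k1 (2 * p + 1) * (K * (z^s * zb^s) ^ p * ?H) * (K * (w^s * wb^s) ^ p * ?H')
    + lam1 k0 k1 (2 * p + 1) * (K * (z^s * zb^s) ^ p * ((c + of_nat q) / c * ?D))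
         * (K * (wb^s * w^s) ^ p * ((c + of_nat q) / c * ?D'))"
    unfolding f0_odd[OF pq] f1_odd[OF pq] K_def[symmetric] mult_minus_left mult_minus_right minus_minus
    by (simp only: ac_simps)
  also have "\<dots> = (z * zb * w * wb) ^ (s * p) * ((lam0 k0 k1 (2 * p + 1) * K\<^sup>2) * (?H * ?H')
     + (lam1 k0 k1 (2 * p + 1) * K\<^sup>2 * (c + of_nat q)) * ((c + of_nat q) / c\<^sup>2) * ?D * ?D')"
  proof -
    \<comment> \<open>Naming the sums makes them atoms, so that the distributive laws do not expand
      them.\<close>
    define r L0 L1 h h' d d' where defs: "r = c + of_nat q" "L0 = lam0 k0 k1 (2 * p + 1)"
      "L1 = lam1 k0 k1 (2 * p + 1)" "h = ?H" "h' = ?H'" "d = ?D" "d' = ?D'"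
    show ?thesis
      unfolding defs[symmetric]
      by (simp add: power_mult_distrib power_mult[symmetric] power2_eq_square ring_distribs ac_simps)
  qed
  also have "\<dots> = (z * zb * w * wb) ^ (s * p) * (((of_nat q - of_nat p) * E_const p q) * (?H * ?H')
     + (- (c + of_nat p) * ((of_nat q - of_nat p) * E_const p q)) * ((c + of_nat q) / c\<^sup>2) * ?D * ?D')"
    unfolding K_def lam0_odd[OF pq] lam1_odd[OF pq] ..
  also have "\<dots> = (of_nat q - of_nat p) * E_const p q * (z * zb * w * wb) ^ (s * p) *
      (?H * ?H' - (c + of_nat p) * (c + of_nat q) / c\<^sup>2 * ?D * ?D')"
  proof -
    define r r' h h' d d' where defs: "r = c + of_nat q" "r' = c + of_nat p"
      "h = ?H" "h' = ?H'" "d = ?D" "d' = ?D'"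
    show ?thesis
      unfolding defs[symmetric]
      by (simp add: right_diff_distrib)
  qed
  finally show ?thesis .
qed

lemma poisson_antisym_even:
  assumes pq: "p + q = m" and j: "j + s * p = j' + s * q"
  shows "(z * zb * w * wb) ^ j * poisson_P s k0 k1 (s * (2 * p)) z zb w wb
    + (z * zb * w * wb) ^ j' * poisson_P s k0 k1 (s * (2 * q)) z zb w wb = 0"
proof -
  have qp: "q + p = m" using pq by simp
  show ?thesis
    by (rule power_mult_antisymmetric[OF j poisson_even_multiple[OF pq]])
       (simp only: poisson_even_multiple[OF qp] E_const_commute[of q p] mult.commute[of "of_nat q" "of_nat p"]
         hyp_commute[of m "- of_nat q" "- of_nat p"] hyp_commute[of m "1 - of_nat q" "1 - of_nat p"])
qed

lemma poisson_antisym_odd: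
  assumes pq: "p + q + 1 = m" and j: "j + s * p = j' + s * q"
  shows "(z * zb * w * wb) ^ j * poisson_P s k0 k1 (s * (2 * p + 1)) z zb w wb
    + (z * zb * w * wb) ^ j' * poisson_P s k0 k1 (s * (2 * q + 1)) z zb w wb = 0"
proof -
  have qp: "q + p + 1 = m" using pq by simp
  show ?thesis
    by (rule power_mult_antisymmetric[OF j poisson_odd_multiple[OF pq]])
       (simp only: poisson_odd_multiple[OF qp] E_const_commute[of q p]
         mult.commute[of "c + of_nat q" "c + of_nat p"] hyp_commute[of m "- of_nat q" "- of_nat p"])
qed

lemma poisson_antisym_mixed:
  assumes pq: "p + q + 1 = m" and t: "t + t' = s" "0 < t" "0 < t'"
    and j: "j + s * p = j' + s * q + t'"
  shows "(z * zb * w * wb) ^ j * poisson_P s k0 k1 (s * (2 * p) + t) z zb w wb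
    + (z * zb * w * wb) ^ j' * poisson_P s k0 k1 (s * (2 * q + 1) + t') z zb w wb = 0"
proof -
  have zs: "z ^ s \<noteq> 0" "zb ^ s \<noteq> 0" "w ^ s \<noteq> 0" "wb ^ s \<noteq> 0" using nz by auto
  define e1 e2 e3 e4 where "e1 = even_part p q (z^s) (zb^s)" and "e2 = even_part p q (zb^s) (z^s)"
    and "e3 = even_part p q (w^s) (wb^s)" and "e4 = even_part p q (wb^s) (w^s)"
  note e_def = e1_def e2_def e3_def e4_def
  define Q Y where "Q = z * zb * w * wb" and "Y = z^t * wb^t * e1 * e4 + zb^t * w^t * e2 * e3"
  have Qs: "(z^s * zb^s) * (w^s * wb^s) = Q ^ s" "(z^s * zb^s) ^ n * (w^s * wb^s) ^ n = Q ^ (s * n)" for n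
    by (simp_all add: Q_def power_mult_distrib power_mult)
  have "poisson_P s k0 k1 (s * (2 * p) + t) z zb w wb
    = lam k0 k1 (2 * p) * (z^t * wb^t * f_sum k0 k1 (2 * p) (z^s) (zb^s) * f_sum k0 k1 (2 * p) (wb^s) (w^s)
          + zb^t * w^t * f_sum k0 k1 (2 * p) (zb^s) (z^s) * f_sum k0 k1 (2 * p) (w^s) (wb^s))"
    using t by (simp add: poisson_P_def Let_def)
  also have "\<dots> = (lam k0 k1 (2 * p) * (pochhammer c p / fact p)\<^sup>2)
       * ((z^s * zb^s) ^ p * (w^s * wb^s) ^ p) * Y"
    unfolding f_sum_even[OF pq zs(1,2)] f_sum_even[OF pq zs(2,1)]
      f_sum_even[OF pq zs(3,4)] f_sum_even[OF pq zs(4,3)] e_def[symmetric] Y_def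
      mult.commute[of "zb^s" "z^s"] mult.commute[of "wb^s" "w^s"]
    by (simp only: power2_eq_square ring_distribs ac_simps)
  finally have P: "poisson_P s k0 k1 (s * (2 * p) + t) z zb w wb = G_const p q * Q ^ (s * p) * Y"
    unfolding lam_even[OF pq] Qs .
  have k': "(s * (2 * q + 1) + t') div s = 2 * q + 1" "(s * (2 * q + 1) + t') mod s = t'"
    using t by (simp_all del: mult_Suc_right)
  have "poisson_P s k0 k1 (s * (2 * q + 1) + t') z zb w wb
    = lam k0 k1 (2 * q + 1) * (z^t' * wb^t' * f_sum k0 k1 (2 * q + 1) (z^s) (zb^s)
            * f_sum k0 k1 (2 * q + 1) (wb^s) (w^s)
          + zb^t' * w^t' * f_sum k0 k1 (2 * q + 1) (zb^s) (z^s) * f_sum k0 k1 (2 * q + 1) (w^s) (wb^s))"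
    using t unfolding poisson_P_def Let_def k' by simp
  also have "\<dots> = (lam k0 k1 (2 * q + 1) * (pochhammer c (q + 1) / fact q)\<^sup>2)
       * ((z^s * zb^s) ^ q * (w^s * wb^s) ^ q)
       * (z^t' * wb^t' * (zb^s * e2) * (w^s * e3) + zb^t' * w^t' * (z^s * e1) * (wb^s * e4))"
    unfolding f_sum_odd[OF pq] odd_part_eq[OF pq zs(1,2)] odd_part_eq[OF pq zs(2,1)]
      odd_part_eq[OF pq zs(3,4)] odd_part_eq[OF pq zs(4,3)] e_def[symmetric]
      mult.commute[of "zb^s" "z^s"] mult.commute[of "wb^s" "w^s"]
    by (simp only: power2_eq_square ring_distribs ac_simps)
  \<comment> \<open>Splitting the powers of exponent \<open>s = t + t'\<close> releases
    \<open>Q ^ t'\<close>; the two summands of \<open>Y\<close> then appear in exchanged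
    order.\<close>
  also have "z^t' * wb^t' * (zb^s * e2) * (w^s * e3) + zb^t' * w^t' * (z^s * e1) * (wb^s * e4) = Q ^ t' * Y"
    unfolding t(1)[symmetric] Q_def Y_def power_add power_mult_distrib
    by (simp only: ring_distribs ac_simps)
  finally have P': "poisson_P s k0 k1 (s * (2 * q + 1) + t') z zb w wb
      = - G_const p q * Q ^ (s * q + t') * Y"
    unfolding lam_odd[OF pq] Qs by (simp add: power_add)
  have "j + s * p = j' + (s * q + t')" using j by simp
  then show ?thesis
    unfolding Q_def[symmetric]
    \<comment> \<open>The choice 1 and 0 makes \<open>x - y\<close> and \<open>y - x\<close> the
      bare signs of \<open>P\<close> and \<open>P'\<close>.\<close>
    by (rule power_mult_antisymmetric[where x = 1 and y = 0 and e = "G_const p q" and X = Y]) (simp_all only: P P', simp_all)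
qed

text \<open>If \<open>s\<close> divides \<open>N\<close>, the quotients of \<open>N\<close> and
  \<open>N'\<close> by \<open>s\<close> add up to \<open>2 * m\<close> and have equal parity.
  Otherwise they add up to \<open>2 * m - 1\<close>, so one is even and the other odd.\<close>

lemma poisson_antisym:
  assumes N: "N + N' = 2 * (s * m)" and j: "N + 2 * j = N' + 2 * j'"
  shows "(z * zb * w * wb) ^ j * poisson_P s k0 k1 N z zb w wb
    + (z * zb * w * wb) ^ j' * poisson_P s k0 k1 N' z zb w wb = 0"
proof -
  define k t where "k = N div s" and "t = N mod s"
  have Nk: "N = s * k + t" "t < s" using s by (auto simp: k_def t_def)
  show ?thesis
  proof (cases "t = 0")
    case True
    have "s * k \<le> N + N'" using Nk by simp
    also have "\<dots> = s * (2 * m)" using N by simp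
    finally have k: "k \<le> 2 * m" using s by simp
    show ?thesis
    proof (cases "even k")
      case even: True
      then obtain p where p: "k = 2 * p" by (rule evenE)
      define q where "q = m - p"
      have q: "p + q = m" using k by (simp add: p q_def)
      have "2 * (s * m) = s * (2 * p) + s * (2 * q)"
        unfolding q[symmetric] by (simp add: ring_distribs)
      then have N1: "N = s * (2 * p)" "N' = s * (2 * q)"
        using N Nk(1) True p by simp_all
      then have "j + s * p = j' + s * q"
        using j by simp
      from poisson_antisym_even[OF q this] show ?thesis by (simp only: N1)
    next
      case False
      then obtain p where p: "k = 2 * p + 1" by (rule oddE)
      define q where "q = m - p - 1"
      have q: "p + q + 1 = m" using k by (simp add: p q_def)
      have "2 * (s * m) = s * (2 * p + 1) + s * (2 * q + 1)"
        unfolding q[symmetric] by (simp add: ring_distribs)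
      then have N1: "N = s * (2 * p + 1)" "N' = s * (2 * q + 1)"
        using N Nk(1) True p by simp_all
      then have "j + s * p = j' + s * q"
        using j by simp
      from poisson_antisym_odd[OF q this] show ?thesis by (simp only: N1)
    qed
  next
    case False
    define t' where "t' = s - t"
    have t: "t + t' = s" "0 < t" "0 < t'" "t' + t = s" using False Nk by (auto simp: t'_def)
    have "s * k < N + N'" using Nk False by simp
    also have "\<dots> = s * (2 * m)" using N by simp
    finally have k: "k < 2 * m" using s by simp
    show ?thesis
    proof (cases "even k")
      case True
      then obtain p where p: "k = 2 * p" by (rule evenE)
      define q where "q = m - p - 1"
      have q: "p + q + 1 = m" using k by (simp add: p q_def)
      have "2 * (s * m) = s * (2 * p) + s * (2 * q + 1) + s"
        unfolding q[symmetric] by (simp add: ring_distribs)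
      then have N1: "N = s * (2 * p) + t" "N' = s * (2 * q + 1) + t'"
        using N Nk(1) p t(1) by simp_all
      have "j + s * p = j' + s * q + t'"
        using j t(1) by (simp add: N1)
      from poisson_antisym_mixed[OF q t(1-3) this] show ?thesis by (simp only: N1)
    next
      case False
      then obtain q where q: "k = 2 * q + 1" by (rule oddE)
      define p where "p = m - q - 1"
      have p: "p + q + 1 = m" using k by (simp add: q p_def)
      have "2 * (s * m) = s * (2 * p) + s * (2 * q + 1) + s"
        unfolding p[symmetric] by (simp add: ring_distribs)
      then have N1: "N = s * (2 * q + 1) + t" "N' = s * (2 * p) + t'"
        using N Nk(1) q t(1) by simp_all
      have "j' + s * p = j + s * q + t"
        using j t(1) by (simp add: N1)
      \<comment> \<open>The mixed relation lists the even quotient first, so \<open>N\<close> and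
        \<open>N'\<close> trade places.\<close>
      from poisson_antisym_mixed[OF p t(4,3,2) this] show ?thesis by (simp only: N1 add.commute)
    qed
  qed
qed

section \<open>Vanishing of the components of large index\<close>

lemma pochhammer_k_sum_zero:
  assumes "r \<ge> m"
  shows "pochhammer (k0 + k1 + 1) r = 0"
proof -
  have "k0 + k1 + 1 = - of_nat (m - 1)" using m by (simp add: k_sum of_nat_diff)
  then show ?thesis using assms m unfolding pochhammer_eq_0_iff by (intro exI[of _ "m - 1"]) simp
qed

lemma poisson_P_zero:
  assumes N: "N > 2 * (s * m)"
  shows "poisson_P s k0 k1 N z zb w wb = 0"
proof -
  define k t where "k = N div s" and "t = N mod s"
  have Nk: "N = s * k + t" "t < s" using s by (auto simp: k_def t_def)
  have k: "k \<ge> 2 * m"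
  proof (rule ccontr)
    assume "\<not> k \<ge> 2 * m"
    then have "Suc k \<le> 2 * m" by simp
    then have "s * Suc k \<le> s * (2 * m)" by (rule mult_le_mono2)
    then show False using Nk N by simp
  qed
  then have kd: "k div 2 \<ge> m" by simp
  have "lam k0 k1 k = 0" "lam1 k0 k1 k = 0" "odd k \<Longrightarrow> lam0 k0 k1 k = 0"
    using pochhammer_k_sum_zero[OF kd] by (simp_all add: lam_def lam1_def lam0_def Let_def)
  \<comment> \<open>For even \<open>k\<close> the Pochhammer symbol in \<open>lam0\<close> is one
    factor shorter. The critical value \<open>k = 2 * m\<close> with \<open>t = 0\<close> would mean
    \<open>N = 2 * (s * m)\<close>, which the strict bound excludes.\<close>
  moreover have "lam0 k0 k1 k = 0" if "t = 0" "even k"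
  proof -
    have "k \<noteq> 2 * m" using that Nk N by auto
    then have "k div 2 - 1 \<ge> m" using k that by (auto elim!: evenE)
    then show ?thesis using that by (simp add: lam0_def pochhammer_k_sum_zero)
  qed
  ultimately show ?thesis
    using N by (auto simp: poisson_P_def Let_def k_def[symmetric] t_def[symmetric])
qed

end

end

section \<open>Specialization of rational functions\<close>

text \<open>\<open>x\<close> lies in the local ring at the root \<open>c\<close> and takes the value \<open>y\<close> there. Being a relation, this
  needs no totalised evaluation map, and it is compatible with all field operations (division by
  \<open>x\<close> requires \<open>y \<noteq> 0\<close>).\<close>

definition specializes :: "'a::idom \<Rightarrow> 'a poly fract \<Rightarrow> 'a fract \<Rightarrow> bool" where
  "specializes c x y \<longleftrightarrow> (\<exists>a b. poly b c \<noteq> 0 \<and> x = to_fract a / to_fract b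
                              \<and> y = to_fract (poly a c) / to_fract (poly b c))"

lemma specializesE:
  assumes "specializes c x y"
  obtains a b where "poly b c \<noteq> 0" "to_fract b \<noteq> 0" "to_fract (poly b c) \<noteq> 0"
    "x = to_fract a / to_fract b" "y = to_fract (poly a c) / to_fract (poly b c)"
proof -
  obtain a b where *: "poly b c \<noteq> 0" "x = to_fract a / to_fract b"
      "y = to_fract (poly a c) / to_fract (poly b c)"
    using assms by (auto simp: specializes_def)
  moreover have "b \<noteq> 0" using *(1) by auto
  ultimately show ?thesis using that by simp
qed

section \<open>Compatibility of specialization with the field operations\<close>

lemma specializes_to_fract: "specializes c (to_fract a) (to_fract (poly a c))"
  unfolding specializes_def by (intro exI[of _ a] exI[of _ 1]) simp

lemma specializes_add:
  assumes "specializes c x y" "specializes c x' y'"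
  shows "specializes c (x + x') (y + y')"
proof -
  from assms(1) obtain a b where 1: "poly b c \<noteq> 0" "to_fract b \<noteq> 0" "to_fract (poly b c) \<noteq> 0"
    "x = to_fract a / to_fract b" "y = to_fract (poly a c) / to_fract (poly b c)" by (rule specializesE)
  from assms(2) obtain a' b' where 2: "poly b' c \<noteq> 0" "to_fract b' \<noteq> 0" "to_fract (poly b' c) \<noteq> 0"
    "x' = to_fract a' / to_fract b'" "y' = to_fract (poly a' c) / to_fract (poly b' c)" by (rule specializesE)
  show ?thesis
    unfolding specializes_def
    using 1 2
    by (intro exI[of _ "a * b' + a' * b"] exI[of _ "b * b'"])
       (simp add: add_frac_eq del: to_fract_eq_0_iff)
qed

lemma specializes_mult:
  assumes "specializes c x y" "specializes c x' y'"
  shows "specializes c (x * x') (y * y')"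
proof -
  from assms(1) obtain a b where 1: "poly b c \<noteq> 0" "to_fract b \<noteq> 0" "to_fract (poly b c) \<noteq> 0"
    "x = to_fract a / to_fract b" "y = to_fract (poly a c) / to_fract (poly b c)" by (rule specializesE)
  from assms(2) obtain a' b' where 2: "poly b' c \<noteq> 0" "to_fract b' \<noteq> 0" "to_fract (poly b' c) \<noteq> 0"
    "x' = to_fract a' / to_fract b'" "y' = to_fract (poly a' c) / to_fract (poly b' c)" by (rule specializesE)
  show ?thesis
    unfolding specializes_def
    using 1 2
    by (intro exI[of _ "a * a'"] exI[of _ "b * b'"]) simp
qed

lemma specializes_inverse:
  assumes "specializes c x y" "y \<noteq> 0"
  shows "specializes c (inverse x) (inverse y)"
proof -
  from assms(1) obtain a b where 1: "poly b c \<noteq> 0" "to_fract b \<noteq> 0" "to_fract (poly b c) \<noteq> 0"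
    "x = to_fract a / to_fract b" "y = to_fract (poly a c) / to_fract (poly b c)" by (rule specializesE)
  show ?thesis
    unfolding specializes_def
    using 1 assms(2)
    by (intro exI[of _ b] exI[of _ a]) simp
qed

lemma to_fract_of_nat: "to_fract (of_nat n) = of_nat n"
  by (induction n) (simp_all only: of_nat_0 of_nat_Suc to_fract_0 to_fract_1 to_fract_add)

lemma specializes_of_nat: "specializes c (of_nat n) (of_nat n)"
  using specializes_to_fract[of c "of_nat n"] by (simp only: poly_of_nat to_fract_of_nat)

lemma specializes_0: "specializes c 0 0" and specializes_1: "specializes c 1 1"
  using specializes_of_nat[of c 0] specializes_of_nat[of c 1] by simp_all

lemma specializes_numeral: "specializes c (numeral n) (numeral n)"
  using specializes_of_nat[of c "numeral n"] by simp

lemma specializes_uminus: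
  assumes "specializes c x y"
  shows "specializes c (- x) (- y)"
  using specializes_mult[OF specializes_to_fract[of c "-1"] assms] by simp

lemma specializes_diff:
  assumes "specializes c x y" "specializes c x' y'"
  shows "specializes c (x - x') (y - y')"
  using specializes_add[OF assms(1) specializes_uminus[OF assms(2)]] by simp

lemma specializes_divide:
  assumes "specializes c x y" "specializes c x' y'" "y' \<noteq> 0"
  shows "specializes c (x / x') (y / y')"
  using specializes_mult[OF assms(1) specializes_inverse[OF assms(2,3)]] by (simp add: divide_inverse)

lemma specializes_power:
  "specializes c x y \<Longrightarrow> specializes c (x ^ n) (y ^ n)"
  by (induction n) (auto intro: specializes_1 specializes_mult)

lemma specializes_sum:
  "(\<And>i. i \<in> A \<Longrightarrow> specializes c (f i) (g i)) \<Longrightarrow> specializes c (sum f A) (sum g A)"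
  by (induction A rule: infinite_finite_induct) (auto intro: specializes_0 specializes_add)

lemma specializes_prod:
  "(\<And>i. i \<in> A \<Longrightarrow> specializes c (f i) (g i)) \<Longrightarrow> specializes c (prod f A) (prod g A)"
  by (induction A rule: infinite_finite_induct) (auto intro: specializes_1 specializes_mult)

lemma specializes_pochhammer:
  "specializes c x y \<Longrightarrow> specializes c (pochhammer x n) (pochhammer y n)"
  unfolding pochhammer_prod by (intro specializes_prod specializes_add specializes_of_nat)

lemma specializes_fact:
  "specializes (c :: 'a :: {idom,ring_char_0}) (fact n) (fact n)"
  using specializes_of_nat[of c "fact n"] by simp

lemmas specializes_intros =
  specializes_0 specializes_1 specializes_numeral specializes_of_nat specializes_fact
  specializes_add specializes_mult specializes_uminus specializes_diff specializes_divide
  specializes_power specializes_sum specializes_pochhammer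

section \<open>Specialization of the polynomials, structure constants and Poisson components\<close>

lemma specializes_jacobi_P:
  fixes c :: "'a :: {idom,ring_char_0}"
  assumes "specializes c \<alpha> \<alpha>'" "specializes c \<beta> \<beta>'" "specializes c x x'"
  shows "specializes c (jacobi_P n \<alpha> \<beta> x) (jacobi_P n \<alpha>' \<beta>' x')"
  unfolding jacobi_P_def using assms by (intro specializes_intros) auto

context
  fixes c :: "'a :: {idom,ring_char_0}" and k0 k1 k0' k1'
  assumes k: "specializes c k0 k0'" "specializes c k1 k1'"
begin

lemma specializes_f:
  assumes "specializes c z z'" "specializes c zb zb'" "z' \<noteq> 0" "zb' \<noteq> 0"
  shows "specializes c (f0 k0 k1 N z zb) (f0 k0' k1' N z' zb')"
    and "specializes c (f1 k0 k1 N z zb) (f1 k0' k1' N z' zb')"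
    and "specializes c (f_sum k0 k1 N z zb) (f_sum k0' k1' N z' zb')"
proof -
  have x: "specializes c (jacobi_arg z zb) (jacobi_arg z' zb')"
    unfolding jacobi_arg_def using assms by (intro specializes_intros) auto
  show *: "specializes c (f0 k0 k1 N z zb) (f0 k0' k1' N z' zb')"
    unfolding f0_def Let_def using assms k x
    by (auto intro!: specializes_intros specializes_jacobi_P)
  show **: "specializes c (f1 k0 k1 N z zb) (f1 k0' k1' N z' zb')"
    unfolding f1_def Let_def using assms k x
    by (auto intro!: specializes_intros specializes_jacobi_P)
  show "specializes c (f_sum k0 k1 N z zb) (f_sum k0' k1' N z' zb')"
    unfolding f_sum_def by (intro specializes_add * **)
qed

text \<open>Every denominator is a product of integer translates of \<open>k0 + 1/2\<close> and
  \<open>k1 + 1/2\<close>, which cannot specialize to zero when the values are not integers.\<close>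

lemma specializes_lam:
  assumes "k0' + 1/2 \<notin> \<int>" "k1' + 1/2 \<notin> \<int>"
  shows "specializes c (lam0 k0 k1 N) (lam0 k0' k1' N)"
    and "specializes c (lam1 k0 k1 N) (lam1 k0' k1' N)"
    and "specializes c (lam k0 k1 N) (lam k0' k1' N)"
proof -
  have nz: "pochhammer (k0' + 1/2) n \<noteq> 0" "pochhammer (k1' + 1/2) n \<noteq> 0"
      "of_nat n + k0' + 1/2 \<noteq> 0" "of_nat n + k1' + 1/2 \<noteq> 0" for n
    using assms pochhammer_nonzero[OF assms(1)] pochhammer_nonzero[OF assms(2)]
      not_Ints_add_nonzero[OF assms(1), of "int n"] not_Ints_add_nonzero[OF assms(2), of "int n"]
    by (auto simp: add_ac)
  show "specializes c (lam0 k0 k1 N) (lam0 k0' k1' N)"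
    unfolding lam0_def Let_def using k nz
    by (auto intro!: specializes_intros)
  show "specializes c (lam1 k0 k1 N) (lam1 k0' k1' N)"
    unfolding lam1_def Let_def using k nz
    by (auto intro!: specializes_intros)
  show "specializes c (lam k0 k1 N) (lam k0' k1' N)"
    unfolding lam_def Let_def using k nz
    by (auto intro!: specializes_intros)
qed

lemma specializes_poisson_P:
  assumes "k0' + 1/2 \<notin> \<int>" "k1' + 1/2 \<notin> \<int>"
    and "specializes c z z'" "specializes c zb zb'" "specializes c w w'" "specializes c wb wb'"
    and "z' \<noteq> 0" "zb' \<noteq> 0" "w' \<noteq> 0" "wb' \<noteq> 0"
  shows "specializes c (poisson_P s k0 k1 N z zb w wb) (poisson_P s k0' k1' N z' zb' w' wb')"
  unfolding poisson_P_def Let_def using assms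
  by (auto intro!: specializes_intros specializes_f specializes_lam)

end

text \<open>A zero value forces the numerator to vanish at \<open>c\<close>, so the linear factor
  cancels; this removes a simple pole.\<close>

lemma specializes_divide_root:
  assumes "specializes c x 0"
  shows "\<exists>y. specializes c (x / to_fract [:- c, 1:]) y"
proof -
  from assms(1) obtain a b where 1: "poly b c \<noteq> 0" "to_fract b \<noteq> 0" "to_fract (poly b c) \<noteq> 0"
    and x: "x = to_fract a / to_fract b" and y: "0 = to_fract (poly a c) / to_fract (poly b c)"
    by (rule specializesE)
  have "poly a c = 0" using 1(3) y by simp
  then obtain a' where a': "a = [:- c, 1:] * a'" unfolding poly_eq_0_iff_dvd by auto
  have "to_fract [:- c, 1:] \<noteq> 0" by simp
  then have "x / to_fract [:- c, 1:] = to_fract a' / to_fract b"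
    unfolding x a' to_fract_mult by (metis nonzero_mult_div_cancel_left times_divide_eq_right)
  then show ?thesis using 1(1) unfolding specializes_def by blast
qed

text \<open>By coprimality the reduced denominator divides every other denominator of
  \<open>x\<close>, in particular one that does not vanish at \<open>c\<close>.\<close>

lemma specializes_imp_not_dvd_denominator:
  fixes c :: "'a :: {factorial_ring_gcd,semiring_gcd_mult_normalize}"
  assumes "specializes c x y"
  shows "\<not> [:- c, 1:] dvd snd (quot_of_fract x)"
proof -
  from assms(1) obtain a b where 1: "poly b c \<noteq> 0" "to_fract b \<noteq> 0" "x = to_fract a / to_fract b"
    by (rule specializesE)
  obtain p q where pq: "quot_of_fract x = (p, q)" by fastforce
  have "coprime p q" "q \<noteq> 0"
    using coprime_quot_of_fract[of x] snd_quot_of_fract_nonzero[of x] by (simp_all add: pq)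
  have "x = to_fract p / to_fract q"
    using quot_to_fract_quot_of_fract[of x] by (simp add: pq quot_to_fract_def Fract_conv_to_fract)
  then have "to_fract a * to_fract q = to_fract p * to_fract b"
    using 1 \<open>q \<noteq> 0\<close> by (simp add: frac_eq_eq)
  then have "a * q = p * b" by (simp flip: to_fract_mult)
  then have "q dvd p * b" by (metis dvd_triv_right)
  then have "q dvd b" using \<open>coprime p q\<close> by (simp add: coprime_commute coprime_dvd_mult_right_iff)
  then show ?thesis
    using 1(1) dvd_trans by (auto simp: pq poly_eq_0_iff_dvd)
qed

section \<open>Cancellation of the residues\<close>

text \<open>The reflection may fix a middle index, so twice the sum is paired off and characteristic
  zero is used.\<close>

lemma sum_antisymmetric:
  fixes T :: "nat \<Rightarrow> 'a::field_char_0"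
  assumes "\<And>j. j \<le> M \<Longrightarrow> T j + T (M - j) = 0"
  shows "(\<Sum>j\<le>M. T j) = 0"
proof -
  have "(\<Sum>j\<le>M. T j) = (\<Sum>j\<le>M. T (M - j))"
    by (rule sum.reindex_bij_witness[of _ "\<lambda>j. M - j" "\<lambda>j. M - j"]) auto
  then have "2 * (\<Sum>j\<le>M. T j) = (\<Sum>j\<le>M. T j + T (M - j))"
    by (simp add: sum.distrib)
  then show ?thesis using assms by simp
qed

text \<open>The condition \<open>j + s * m \<le> n\<close> selects the summands with a pole, and
  \<open>a\<close> stands for the part of the denominator common to all of them.\<close>

lemma residue_sum_zero:
  fixes c k0 k1 :: "'a::field_char_0"
  assumes c: "c \<notin> \<int>" and m: "m \<ge> 1" and k: "k0 + 1/2 = c" "k1 + 1/2 = 1 - of_nat m - c"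
    and s: "s \<ge> 1" and nz: "z \<noteq> 0" "zb \<noteq> 0" "w \<noteq> 0" "wb \<noteq> 0"
  shows "(\<Sum>j\<in>{j\<in>{0..n div 2}. j + s * m \<le> n}.
           1 / (fact j * (a * fact (n - j - s * m))) * (z * zb * w * wb) ^ j
             * poisson_P s k0 k1 (n - 2 * j) z zb w wb) = 0"
proof (cases "s * m \<le> n")
  case False
  then have *: "{j\<in>{0..n div 2}. j + s * m \<le> n} = {}" by auto
  show ?thesis unfolding * by simp
next
  case True
  define M where "M = n - s * m"
  define Q where "Q = z * zb * w * wb"
  define T where "T j = 1 / (fact j * (a * fact (n - j - s * m))) * Q ^ j
             * poisson_P s k0 k1 (n - 2 * j) z zb w wb" for j
  have T: "T j = 1 / (a * (fact j * fact (M - j))) * (Q ^ j * poisson_P s k0 k1 (n - 2 * j) z zb w wb)"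
    if "j \<le> M" for j
    using that by (simp add: T_def M_def ac_simps)
  \<comment> \<open>If the partner \<open>M - j\<close> lies outside the range of summation, then
    \<open>n - 2 * j\<close> exceeds \<open>2 * (s * m)\<close> and the component itself
    vanishes.\<close>
  have zero: "T j = 0" if "j \<le> M" "2 * (M - j) > n" for j
  proof -
    have "n - 2 * j > 2 * (s * m)" using that by (auto simp: M_def)
    from poisson_P_zero[OF c m k s nz this] show ?thesis by (simp add: T_def)
  qed
  \<comment> \<open>Extension by zero gives an index range invariant under
    \<open>j \<mapsto> M - j\<close>.\<close>
  have "(\<Sum>j\<in>{j\<in>{0..n div 2}. j + s * m \<le> n}. T j) = (\<Sum>j\<le>M. if 2 * j \<le> n then T j else 0)"
    using True by (intro sum.mono_neutral_cong_left) (auto simp: M_def)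
  also have "\<dots> = 0"
  proof (rule sum_antisymmetric)
    fix j assume j: "j \<le> M"
    show "(if 2 * j \<le> n then T j else 0) + (if 2 * (M - j) \<le> n then T (M - j) else 0) = 0"
    proof (cases "2 * j \<le> n \<and> 2 * (M - j) \<le> n")
      case False
      then show ?thesis using zero[of j] zero[of "M - j"] j by auto
    next
      case both: True
      have "n - 2 * j + (n - 2 * (M - j)) = 2 * (s * m)"
        "n - 2 * j + 2 * j = n - 2 * (M - j) + 2 * (M - j)"
        using both j True by (auto simp: M_def)
      from poisson_antisym[OF c m k s nz this]
      have "Q ^ j * poisson_P s k0 k1 (n - 2 * j) z zb w wb
        + Q ^ (M - j) * poisson_P s k0 k1 (n - 2 * (M - j)) z zb w wb = 0"
        by (simp add: Q_def)
      moreover have "T (M - j) = 1 / (a * (fact j * fact (M - j)))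
          * (Q ^ (M - j) * poisson_P s k0 k1 (n - 2 * (M - j)) z zb w wb)"
        using j T[of "M - j"] by (simp add: ac_simps)
      ultimately show ?thesis
        unfolding T[OF j] using both by (simp flip: distrib_left add_divide_distrib)
    qed
  qed
  finally show ?thesis by (simp add: T_def Q_def)
qed

text \<open>The singular summands together are \<open>1 / \<epsilon>\<close> times a regular sum
  whose value is the vanishing residue sum; the other summands are regular individually.\<close>

lemma kernel_K_regular:
  fixes c :: "'a :: {idom,ring_char_0}" and k0' k1' :: "'a fract"
  assumes k: "specializes c k0 k0'" "specializes c k1 k1'"
    and c': "c' \<notin> \<int>" and m: "m \<ge> 1" and k': "k0' + 1/2 = c'" "k1' + 1/2 = 1 - of_nat m - c'"
    and \<epsilon>: "k0 + k1 + of_nat m = to_fract [:- c, 1:]"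
    and s: "s \<ge> 1"
    and v: "specializes c z z'" "specializes c zb zb'" "specializes c w w'" "specializes c wb wb'"
    and nz: "z' \<noteq> 0" "zb' \<noteq> 0" "w' \<noteq> 0" "wb' \<noteq> 0"
  shows "\<exists>y. specializes c (kernel_K s k0 k1 n z zb w wb) y"
proof -
  define \<epsilon> where "\<epsilon> = to_fract [:- c, 1:]"
  define \<sigma> where "\<sigma> = of_nat s * k0 + of_nat s * k1 + 1"
  define Q where "Q = z * zb * w * wb"
  define P where "P N = poisson_P s k0 k1 N z zb w wb" for N
  define P' where "P' N = poisson_P s k0' k1' N z' zb' w' wb'" for N
  define T where "T j = 1 / (fact j * pochhammer \<sigma> (n - j)) * Q ^ j * P (n - 2 * j)" for j
  define J where "J = {j\<in>{0..n div 2}. j + s * m \<le> n}"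
  have sm: "s * m \<ge> 1" using s m by simp
  have k_sum': "k0' + k1' = - of_nat m" by (rule k_sum[OF c' m k'])
  have "k1' + 1/2 \<notin> \<int>"
  proof
    assume "k1' + 1/2 \<in> \<int>"
    then have "1 - of_nat m - (k1' + 1/2) \<in> \<int>" by (intro Ints_diff Ints_1 Ints_of_nat)
    then show False using c' by (simp add: k'(2))
  qed
  then have P: "specializes c (P N) (P' N)" for N
    unfolding P_def P'_def using c' k'(1) by (intro specializes_poisson_P k v nz) auto
  have Q: "specializes c Q (z' * zb' * w' * wb')"
    unfolding Q_def by (intro specializes_mult v)
  have "of_nat s * k0' + of_nat s * k1' + 1 = of_nat s * (k0' + k1') + 1"
    by (simp add: ring_distribs)
  also have "\<dots> = - of_nat (s * m - 1)"
    using sm by (simp add: k_sum' of_nat_diff)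
  finally have *: "of_nat s * k0' + of_nat s * k1' + 1 = - of_nat (s * m - 1)" .
  have \<sigma>: "specializes c \<sigma> (- of_nat (s * m - 1))"
    unfolding \<sigma>_def *[symmetric] by (intro specializes_intros k)
  \<comment> \<open>The \<open>s * m - 1\<close> factors before the vanishing one; their values are
    nonzero integers.\<close>
  define A where "A = pochhammer \<sigma> (s * m - 1)"
  define A' :: "'a fract" where "A' = pochhammer (- of_nat (s * m - 1)) (s * m - 1)"
  have A: "specializes c A A'" "A' \<noteq> 0"
    unfolding A_def A'_def using \<sigma>
    by (auto intro!: specializes_pochhammer simp: pochhammer_of_nat_eq_0_iff simp del: of_nat_diff)
  \<comment> \<open>The factors after the vanishing one take the values 1, 2, and so on, hence the
    factorial.\<close>
  have B: "specializes c (pochhammer (\<sigma> + of_nat (s * m)) r) (fact r)" for r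
  proof -
    have "- of_nat (s * m - 1) + of_nat (s * m) = (1 :: 'a fract)"
      using sm by (simp add: of_nat_diff)
    then show ?thesis
      using specializes_pochhammer[OF specializes_add[OF \<sigma> specializes_of_nat[of c "s * m"]], of r]
      by (simp only: pochhammer_fact)
  qed
  \<comment> \<open>The factor at position \<open>s * m - 1\<close>, counted from 0, is
    \<open>s * (k0 + k1 + m)\<close>, the only source of the pole.\<close>
  have split: "pochhammer \<sigma> (n - j) = \<epsilon> * (A * of_nat s * pochhammer (\<sigma> + of_nat (s * m)) (n - j - s * m))"
    if "j + s * m \<le> n" for j
  proof -
    have "\<sigma> + of_nat (s * m - 1) = of_nat s * (k0 + k1 + of_nat m)"
      using sm by (simp add: \<sigma>_def of_nat_diff algebra_simps)
    then have "\<sigma> + of_nat (s * m - 1) = of_nat s * \<epsilon>"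
      unfolding \<epsilon> \<epsilon>_def .
    moreover have "pochhammer \<sigma> (s * m) = A * (\<sigma> + of_nat (s * m - 1))"
      using sm pochhammer_Suc[of \<sigma> "s * m - 1"] by (simp add: A_def)
    moreover have "pochhammer \<sigma> (n - j) = pochhammer \<sigma> (s * m) * pochhammer (\<sigma> + of_nat (s * m)) (n - j - s * m)"
      using that by (intro pochhammer_product) simp
    ultimately show ?thesis by (simp add: ac_simps)
  qed
  define S where "S j = 1 / (fact j * (A * of_nat s * pochhammer (\<sigma> + of_nat (s * m)) (n - j - s * m)))
     * Q ^ j * P (n - 2 * j)" for j
  have "specializes c (sum S J) (\<Sum>j\<in>J. 1 / (fact j * (A' * of_nat s * fact (n - j - s * m)))
     * (z' * zb' * w' * wb') ^ j * P' (n - 2 * j))"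
    unfolding S_def using A s by (intro specializes_intros B P Q) auto
  also have "(\<Sum>j\<in>J. 1 / (fact j * (A' * of_nat s * fact (n - j - s * m)))
     * (z' * zb' * w' * wb') ^ j * P' (n - 2 * j)) = 0"
    unfolding J_def P'_def by (rule residue_sum_zero[OF c' m k' s nz])
  finally obtain y where y: "specializes c (sum S J / \<epsilon>) y"
    unfolding \<epsilon>_def using specializes_divide_root by blast
  have "specializes c (sum T ({0..n div 2} - J))
    (\<Sum>j\<in>{0..n div 2} - J. 1 / (fact j * pochhammer (- of_nat (s * m - 1)) (n - j))
       * (z' * zb' * w' * wb') ^ j * P' (n - 2 * j))" (is "specializes _ _ ?y")
    unfolding T_def
    \<comment> \<open>Outside \<open>J\<close> the length \<open>n - j\<close> is at most
      \<open>s * m - 1\<close>, so the Pochhammer symbol stops before its zero factor.\<close>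
    by (intro specializes_intros P Q \<sigma>)
       (auto simp: J_def pochhammer_of_nat_eq_0_iff simp del: of_nat_diff)
  moreover have "sum T J = sum S J / \<epsilon>"
    unfolding sum_divide_distrib
    by (intro sum.cong) (auto simp: T_def S_def J_def split)
  moreover have "sum T {0..n div 2} = sum T ({0..n div 2} - J) + sum T J"
    by (rule sum.subset_diff) (auto simp: J_def)
  ultimately have "specializes c (sum T {0..n div 2}) (?y + y)"
    using specializes_add[OF _ y] by (simp only:)
  then have "specializes c (1 / 2 ^ n * sum T {0..n div 2}) (1 / 2 ^ n * (?y + y))"
    by (intro specializes_intros) auto
  then show ?thesis
    unfolding kernel_K_def T_def \<sigma>_def Q_def P_def by (rule exI)
qed

text \<open>After doubling, \<open>2 * X + 1\<close> would equal an integer constant, contradicted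
  by the coefficient of degree 1.\<close>

lemma to_fract_X_plus_half_not_Ints: "to_fract [:0, 1 :: 'a::{idom,ring_char_0}:] + 1/2 \<notin> \<int>"
proof
  let ?X = "[:0, 1 :: 'a:]"
  assume "to_fract ?X + 1/2 \<in> \<int>"
  then obtain i where "to_fract ?X + 1/2 = of_int i" by (elim Ints_cases)
  then have i: "2 * to_fract ?X + 1 = of_int (2 * i)" by (simp add: field_simps)
  have "2 * to_fract ?X + 1 = to_fract (?X + ?X + 1)"
    by (simp only: to_fract_add to_fract_1 mult_2)
  moreover have "of_int k = to_fract (of_int k :: 'a poly)" for k
    by (cases k) (simp_all only: of_int_of_nat_eq of_int_minus to_fract_of_nat to_fract_uminus)
  ultimately have "?X + ?X + 1 = of_int (2 * i)"
    using i by (simp only: to_fract_eq_iff)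
  then have "coeff (?X + ?X + 1) 1 = coeff (of_int (2 * i)) 1" by (rule arg_cong)
  then show False by (simp add: of_int_poly)
qed

theorem theorem4:
  fixes s n m :: nat
  assumes "s \<ge> 1" and "n \<ge> 1" and "m \<ge> 1"
  shows "\<not> (kappa0 + kappa1 + of_nat m) dvd snd (quot_of_fract (K_rat s n))"
proof -
  \<comment> \<open>As \<open>kappa1\<close> is the outer variable, the divisor is monic and linear
    in it with root \<open>c = - X - m\<close>, where \<open>X\<close> is \<open>kappa0\<close> in
    the coefficient ring. Specialization is evaluation of \<open>kappa1\<close> at
    \<open>c\<close>.\<close>
  define X :: "coeff_ring poly" where "X = [:0, 1:]"
  define c where "c = - X - of_nat m"
  have d: "kappa0 + kappa1 + of_nat m = [:- c, 1:]"
    by (simp add: kappa0_def kappa1_def c_def X_def of_nat_poly)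
  have k: "specializes c (to_fract kappa0) (to_fract X)" "specializes c (to_fract kappa1) (to_fract c)"
    using specializes_to_fract[of c kappa0] specializes_to_fract[of c kappa1]
    by (simp_all add: kappa0_def kappa1_def X_def)
  have v: "specializes c (coeff_embed a) (to_fract [:a:])" for a
    using specializes_to_fract[of c "[:[:a:]:]"] by (simp add: coeff_embed_def)
  have "to_fract c + 1/2 = 1 - of_nat m - (to_fract X + 1/2)"
    by (simp add: c_def to_fract_of_nat field_simps)
  moreover have "to_fract kappa0 + to_fract kappa1 + of_nat m = to_fract [:- c, 1:]"
    unfolding d[symmetric] to_fract_add to_fract_of_nat ..
  ultimately have "\<exists>y. specializes c (K_rat s n) y"
    unfolding K_rat_def using to_fract_X_plus_half_not_Ints assms
    by (intro kernel_K_regular[OF k _ _ refl _ _ _ v v v v])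
       (auto simp: X_def Z_var_def Zb_var_def W_var_def Wb_var_def)
  then show ?thesis
    unfolding d using specializes_imp_not_dvd_denominator by blast
qed

end
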